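(* Let $\mathbb{K}$ be a field and let $\mathcal{A}$ be a (small) $\mathcal{A}_\infty$-category over $\mathbb{K}$. Then the simplicial nerve $N_{\mathcal{A}_\infty}(\mathcal{A})$ is an $\infty$-category; that is, for all $0<i<n$ every map of simplicial sets $\Lambda^n_i\to N_{\mathcal{A}_\infty}(\mathcal{A})$ extends along the inclusion $\Lambda^n_i\hookrightarrow\Delta^n$ to a map $\Delta^n\to N_{\mathcal{A}_\infty}(\mathcal{A})$.
   Context: Graded conventions. All graded vector spaces are $\mathbb{Z}$-graded over $\mathbb{K}$; for homogeneous maps, $(f\otimes g)(x\otimes y)=(-1)^{\deg(x)\deg(g)}f(x)\otimes g(y)$. $\mathcal{A}_\infty$-category. An $\mathcal{A}_\infty$-category $\mathcal{A}$ over $\mathbb{K}$ consists of: a set $Ob(\mathcal{A})$; for all objects $x,y$ a graded vector space $Hom^\bullet_{\mathcal{A}}(x,y)$; for each $n\ge1$ and objects $x_0,\dots,x_n$ a graded map $m_n:Hom^\bullet_{\mathcal{A}}(x_{n-1},x_n)\otimes\dots\otimes Hom^\bullet_{\mathcal{A}}(x_0,x_1)\to Hom^\bullet_{\mathcal{A}}(x_0,x_n)$ of degree $2-n$ such that for every $n\ge1$ $$\sum_{n=r+t+s}(-1)^{sr+t}m_{r+t+1}(Id^{\otimes r}\otimes m_s\otimes Id^{\otimes t})=0\qquad(r,t\ge0,\ s\ge1);$$ and for each object $x$ a degree $0$ element $1_x\in Hom^\bullet_{\mathcal{A}}(x,x)$ with $m_2(1_x\otimes a)=a$ and $m_2(a\otimes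 1_x)=a$ whenever these make sense, and such that for $n>2$, $m_n$ vanishes whenever one of its arguments is an identity $1_x$. $\mathcal{A}_\infty$-functor. An $\mathcal{A}_\infty$-functor $f:\mathcal{A}\to\mathcal{B}$ consists of a map $f_0:Ob(\mathcal{A})\to Ob(\mathcal{B})$ and, for $n\ge1$ and objects $x_0,\dots,x_n$, graded maps $f_n:Hom^\bullet_{\mathcal{A}}(x_{n-1},x_n)\otimes\dots\otimes Hom^\bullet_{\mathcal{A}}(x_0,x_1)\to Hom^\bullet_{\mathcal{B}}(f_0(x_0),f_0(x_n))$ of degree $1-n$ such that for every $n\ge1$ $$\sum_{n=r+t+s}(-1)^{sr+t}f_{r+t+1}(Id^{\otimes r}\otimes m_s\otimes Id^{\otimes t})=\sum_{\substack{1\le r\le n\\ i_1+\dots+i_r=n}}(-1)^{\epsilon_r(i_1,\dots,i_r)}m'_r(f_{i_1}\otimes\dots\otimes f_{i_r}),$$ where $m'$ denotes the operations of $\mathcal{B}$ and $\epsilon_r(i_1,\dots,i_r)=\sum_{2\le k\le r}\big((1-i_k)\sum_{1\le l\le k-1}i_l\big)$; moreover $f_1(1_x)=1_{f_0(x)}$ and, for $n>1$, $f_n$ vanishes whenever one of its arguments is an identity. Composition is given on objects by composition of maps and by $(f\circ g)_k=\sum_{r=1}^k\sum_{i_1+\dots+i_r=k}(-1)^{\epsilon_r(i_1,\dots,i_r)}f_r(g_{i_1}\otimes\dots\otimes g_{i_r})$. This gives the category $\mathcal{A}_\infty Cat_{\mathbb{K}}$ of small $\mathcal{A}_\infty$-categories.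 The $\mathcal{A}_\infty$-category $\mathcal{A}_\infty[\Delta^n]$. Its objects are $0,1,\dots,n$; $Hom^\bullet(i,j)=\mathbb{K}\cdot(i,j)$ is one-dimensional with generator $(i,j)$ in degree $0$ if $i\le j$, and is $0$ if $i>j$; $m_1=0$, $m_2((j,k)\otimes(i,j))=(i,k)$ for $i\le j\le k$, and $m_n=0$ for $n>2$; the identity of $i$ is $(i,i)$. A monotone map $\theta:[m]\to[n]$ induces the $\mathcal{A}_\infty$-functor $\theta_\star:\mathcal{A}_\infty[\Delta^m]\to\mathcal{A}_\infty[\Delta^n]$ with $\theta_{\star,0}(k)=\theta(k)$, $\theta_{\star,1}(i,j)=(\theta(i),\theta(j))$, $\theta_{\star,p}=0$ for $p\ge2$; this makes $[n]\mapsto\mathcal{A}_\infty[\Delta^n]$ a cosimplicial object of $\mathcal{A}_\infty Cat_{\mathbb{K}}$. Simplicial nerve. $N_{\mathcal{A}_\infty}(\mathcal{A})$ is the simplicial set with $N_{\mathcal{A}_\infty}(\mathcal{A})_n=Hom_{\mathcal{A}_\infty Cat_{\mathbb{K}}}(\mathcal{A}_\infty[\Delta^n],\mathcal{A})$ and simplicial structure induced by precomposition with the functors $\theta_\star$. *)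

theory Defs
  imports Complex_Main "HOL-Library.FuncSet"
begin

section \<open>Graded vector spaces and graded multilinear maps\<close>

text \<open>
  A graded vector space is given by its family of homogeneous components.  All components of all
  morphism spaces are subspaces of one ambient vector space \<open>'v\<close>; this is no restriction, since any
  set-indexed family of vector spaces embeds into its direct sum.  A homogeneous morphism carries its
  source, target and degree as tags, so components with different tags are never identified, even
  if they overlap inside \<open>'v\<close>.  A graded map out of a tensor product is rendered as a multilinear
  map on lists of homogeneous elements: the list \<open>[a\<^sub>n, ..., a\<^sub>1]\<close> stands for
  \<open>a\<^sub>n \<otimes> ... \<otimes> a\<^sub>1\<close> with \<open>a\<^sub>k\<close> from \<open>x\<^bsub>k-1\<^esub>\<close> to \<open>x\<^sub>k\<close>.
\<close>

datatype ('o, 'v) harr = Harr (src: 'o) (tgt: 'o) (deg: int) (val: 'v)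

record ('k, 'o, 'v) ainf =
  ob :: "'o set"
  hom :: "'o \<Rightarrow> 'o \<Rightarrow> int \<Rightarrow> 'v set"
  scl :: "'k \<Rightarrow> 'v \<Rightarrow> 'v"
  opr :: "('o, 'v) harr list \<Rightarrow> 'v"
  idt :: "'o \<Rightarrow> 'v"

definition is_arr :: "('k, 'o, 'v) ainf \<Rightarrow> ('o, 'v) harr \<Rightarrow> bool" where
  "is_arr A a \<longleftrightarrow> src a \<in> ob A \<and> tgt a \<in> ob A \<and> val a \<in> hom A (src a) (tgt a) (deg a)"

definition composable :: "('k, 'o, 'v) ainf \<Rightarrow> ('o, 'v) harr list \<Rightarrow> bool" where
  "composable A as \<longleftrightarrow>
     as \<noteq> [] \<and> (\<forall>a\<in>set as. is_arr A a) \<and> successively (\<lambda>a b. src a = tgt b) as"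

definition id_arr :: "('k, 'o, 'v) ainf \<Rightarrow> 'o \<Rightarrow> ('o, 'v) harr" where
  "id_arr A x = Harr x x 0 (idt A x)"

definition degsum :: "('o, 'v) harr list \<Rightarrow> int" where
  "degsum as = sum_list (map deg as)"

text \<open>The homogeneous element \<open>F(as)\<close>, where the \<open>n\<close>-ary component of \<open>F\<close> has degree \<open>d - n\<close> and
  \<open>p\<close> is the action on objects.\<close>

definition arr_of ::
  "('o \<Rightarrow> 'p) \<Rightarrow> int \<Rightarrow> (('o, 'v) harr list \<Rightarrow> 'w) \<Rightarrow> ('o, 'v) harr list \<Rightarrow> ('p, 'w) harr" where
  "arr_of p d F as =
     Harr (p (src (last as))) (p (tgt (hd as))) (degsum as + d - int (length as)) (F as)"

definition graded_multilinear ::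
  "('k, 'o, 'v::ab_group_add) ainf \<Rightarrow> ('k, 'p, 'w::ab_group_add) ainf \<Rightarrow> ('o \<Rightarrow> 'p) \<Rightarrow> int \<Rightarrow>
   (('o, 'v) harr list \<Rightarrow> 'w) \<Rightarrow> bool" where
  "graded_multilinear A B p d F \<longleftrightarrow>
     (\<forall>as. composable A as \<longrightarrow> is_arr B (arr_of p d F as)) \<and>
     (\<forall>as bs x y e u v.
        composable A (as @ Harr x y e u # bs) \<longrightarrow> composable A (as @ Harr x y e v # bs) \<longrightarrow>
        F (as @ Harr x y e (u + v) # bs) = F (as @ Harr x y e u # bs) + F (as @ Harr x y e v # bs)) \<and>
     (\<forall>as bs x y e u c.
        composable A (as @ Harr x y e u # bs) \<longrightarrow>
        F (as @ Harr x y e (scl A c u) # bs) = scl B c (F (as @ Harr x y e u # bs)))"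


section \<open>The sums in the defining equations\<close>

definition sgn_pow :: "int \<Rightarrow> 'v::ab_group_add \<Rightarrow> 'v" where
  "sgn_pow e v = (if even e then v else - v)"

text \<open>
  \<open>\<Sum> (-1)\<^bsup>sr+t\<^esup> F (Id\<^bsup>r\<^esup> \<otimes> m\<^sub>s \<otimes> Id\<^bsup>t\<^esup>)\<close> evaluated on \<open>as\<close>.  The summand \<open>(2 - s) * degsum (take r as)\<close>
  of the exponent is the Koszul sign from moving \<open>m\<^sub>s\<close>, of degree \<open>2 - s\<close>, past the first \<open>r\<close>
  arguments.
\<close>

definition insertion_sum ::
  "('k, 'o, 'v) ainf \<Rightarrow> (('o, 'v) harr list \<Rightarrow> 'w::ab_group_add) \<Rightarrow> ('o, 'v) harr list \<Rightarrow> 'w" where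
  "insertion_sum A F as =
     (\<Sum>(r, s, t) \<in> {(r, s, t). r + s + t = length as \<and> 1 \<le> s}.
        sgn_pow (int s * int r + int t + (2 - int s) * degsum (take r as))
          (F (take r as @ arr_of id 2 (opr A) (take s (drop r as)) # drop (r + s) as)))"

lemma finite_insertions: "finite {(r, s, t). r + s + t = (n::nat) \<and> 1 \<le> s}"
  by (rule finite_subset[of _ "{..n} \<times> {..n} \<times> {..n}"]) auto

text \<open>The tuples \<open>(i\<^sub>1, ..., i\<^sub>r)\<close> of positive integers with sum \<open>n\<close>, for all \<open>r\<close>.\<close>

definition compositions :: "nat \<Rightarrow> nat list set" where
  "compositions n = {is. sum_list is = n \<and> (\<forall>i\<in>set is. 1 \<le> i)}"

lemma finite_compositions: "finite (compositions n)"
proof (rule finite_subset)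
  have "length is \<le> sum_list is" if "\<forall>i\<in>set is. (1::nat) \<le> i" for "is"
    using that by (induction "is") auto
  then show "compositions n \<subseteq> {is. set is \<subseteq> {..n} \<and> length is \<le> n}"
    by (auto simp: compositions_def member_le_sum_list)
  show "finite {is. set is \<subseteq> {..n} \<and> length is \<le> n}"
    by (rule finite_lists_length_le) simp
qed

fun blocks :: "nat list \<Rightarrow> 'a list \<Rightarrow> 'a list list" where
  "blocks [] as = []"
| "blocks (i # is) as = take i as # blocks is (drop i as)"

text \<open>\<open>\<epsilon>\<^sub>r(i\<^sub>1, ..., i\<^sub>r)\<close>, with indices shifted to start at \<open>0\<close>; the term for the first index is
  an empty sum.\<close>

definition eps :: "nat list \<Rightarrow> int" where
  "eps is = (\<Sum>k<length is. (1 - int (is ! k)) * (\<Sum>l<k. int (is ! l)))"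

text \<open>The exponent of the Koszul sign in evaluating \<open>g\<^bsub>i_1\<^esub> \<otimes> ... \<otimes> g\<^bsub>i_r\<^esub>\<close>, with \<open>g\<^sub>i\<close> of degree \<open>1 - i\<close>, on
  the blocks \<open>bs\<close> of its arguments: each \<open>g\<^bsub>i_k\<^esub>\<close> moves past all earlier blocks.\<close>

definition koszul :: "('o, 'v) harr list list \<Rightarrow> int" where
  "koszul bs = (\<Sum>k<length bs. (1 - int (length (bs ! k))) * (\<Sum>l<k. degsum (bs ! l)))"

text \<open>\<open>\<Sum> (-1)\<^bsup>\<epsilon>\<^esup> F\<^sub>r (g\<^bsub>i_1\<^esub> \<otimes> ... \<otimes> g\<^bsub>i_r\<^esub>)\<close> evaluated on \<open>as\<close>, where \<open>g\<close> acts on objects by \<open>g0\<close>.\<close>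

definition tensor_sum ::
  "(('p, 'w) harr list \<Rightarrow> 'u::ab_group_add) \<Rightarrow> ('o \<Rightarrow> 'p) \<Rightarrow> (('o, 'v) harr list \<Rightarrow> 'w) \<Rightarrow>
   ('o, 'v) harr list \<Rightarrow> 'u" where
  "tensor_sum F g0 g as =
     (\<Sum>is \<in> compositions (length as).
        sgn_pow (eps is + koszul (blocks is as)) (F (map (arr_of g0 1 g) (blocks is as))))"


section \<open>$A_\infty$-categories and $A_\infty$-functors\<close>

locale ainf_category =
  fixes A :: "('k::field, 'o, 'v::ab_group_add) ainf"
  assumes vector_space_scl: "vector_space (scl A)"
    and subspace_hom:
      "x \<in> ob A \<Longrightarrow> y \<in> ob A \<Longrightarrow> module.subspace (scl A) (hom A x y d)"
    and opr_multilinear: "graded_multilinear A A id 2 (opr A)"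
    and ainf_relation: "composable A as \<Longrightarrow> insertion_sum A (opr A) as = 0"
    and idt_in_hom: "x \<in> ob A \<Longrightarrow> idt A x \<in> hom A x x 0"
    and opr_id_left: "is_arr A a \<Longrightarrow> opr A [id_arr A (tgt a), a] = val a"
    and opr_id_right: "is_arr A a \<Longrightarrow> opr A [a, id_arr A (src a)] = val a"
    and opr_id_vanish:
      "composable A as \<Longrightarrow> length as > 2 \<Longrightarrow> x \<in> ob A \<Longrightarrow> id_arr A x \<in> set as \<Longrightarrow> opr A as = 0"

record ('o, 'v, 'p, 'w) ainf_fun =
  on_ob :: "'o \<Rightarrow> 'p"
  on_arr :: "('o, 'v) harr list \<Rightarrow> 'w"

text \<open>Functors are normalised outside their domain, so that equality of functors is equality of
  records.\<close>

locale ainf_functor =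
  fixes A :: "('k::field, 'o, 'v::ab_group_add) ainf"
    and B :: "('k, 'p, 'w::ab_group_add) ainf"
    and f :: "('o, 'v, 'p, 'w) ainf_fun"
  assumes on_ob_funcset: "on_ob f \<in> ob A \<rightarrow>\<^sub>E ob B"
    and on_arr_extensional: "\<not> composable A as \<Longrightarrow> on_arr f as = 0"
    and on_arr_multilinear: "graded_multilinear A B (on_ob f) 1 (on_arr f)"
    and functor_relation:
      "composable A as \<Longrightarrow>
         insertion_sum A (on_arr f) as = tensor_sum (opr B) (on_ob f) (on_arr f) as"
    and on_arr_id: "x \<in> ob A \<Longrightarrow> on_arr f [id_arr A x] = idt B (on_ob f x)"
    and on_arr_id_vanish:
      "composable A as \<Longrightarrow> length as > 1 \<Longrightarrow> x \<in> ob A \<Longrightarrow> id_arr A x \<in> set as \<Longrightarrow> on_arr f as = 0"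

text \<open>The composite \<open>f \<circ> g\<close> of \<open>g\<close>, with source \<open>A\<close>, and \<open>f\<close>.\<close>

definition ainf_fun_comp ::
  "('k, 'o, 'v) ainf \<Rightarrow> ('p, 'w, 'q, 'u::ab_group_add) ainf_fun \<Rightarrow> ('o, 'v, 'p, 'w) ainf_fun \<Rightarrow>
   ('o, 'v, 'q, 'u) ainf_fun" where
  "ainf_fun_comp A f g =
     \<lparr>on_ob = compose (ob A) (on_ob f) (on_ob g),
      on_arr = (\<lambda>as. if composable A as then tensor_sum (on_arr f) (on_ob g) (on_arr g) as else 0)\<rparr>"


section \<open>Simplicial sets and $\infty$-categories\<close>

text \<open>Monotone maps \<open>[m] \<rightarrow> [n]\<close>, extensional outside \<open>[m] = {..m}\<close>.\<close>

definition delta_maps :: "nat \<Rightarrow> nat \<Rightarrow> (nat \<Rightarrow> nat) set" where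
  "delta_maps m n = {\<theta> \<in> {..m} \<rightarrow>\<^sub>E {..n}. mono_on {..m} \<theta>}"

text \<open>\<open>act X m n \<theta>\<close> is the map \<open>X\<^sub>n \<rightarrow> X\<^sub>m\<close> induced by \<open>\<theta> : [m] \<rightarrow> [n]\<close>.\<close>

record 'a sset =
  simp :: "nat \<Rightarrow> 'a set"
  act :: "nat \<Rightarrow> nat \<Rightarrow> (nat \<Rightarrow> nat) \<Rightarrow> 'a \<Rightarrow> 'a"

definition simplicial_set :: "'a sset \<Rightarrow> bool" where
  "simplicial_set X \<longleftrightarrow>
     (\<forall>m n. \<forall>\<theta> \<in> delta_maps m n. act X m n \<theta> \<in> simp X n \<rightarrow> simp X m) \<and>
     (\<forall>n. \<forall>x \<in> simp X n. act X n n (\<lambda>i\<in>{..n}. i) x = x) \<and>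
     (\<forall>l m n. \<forall>\<eta> \<in> delta_maps l m. \<forall>\<theta> \<in> delta_maps m n. \<forall>x \<in> simp X n.
        act X l n (compose {..l} \<theta> \<eta>) x = act X l m \<eta> (act X m n \<theta> x))"

definition simplicial_map :: "'a sset \<Rightarrow> 'b sset \<Rightarrow> (nat \<Rightarrow> 'a \<Rightarrow> 'b) \<Rightarrow> bool" where
  "simplicial_map X Y g \<longleftrightarrow>
     (\<forall>n. g n \<in> simp X n \<rightarrow> simp Y n) \<and>
     (\<forall>m n. \<forall>\<theta> \<in> delta_maps m n. \<forall>x \<in> simp X n. g m (act X m n \<theta> x) = act Y m n \<theta> (g n x))"

definition std_simplex :: "nat \<Rightarrow> (nat \<Rightarrow> nat) sset" where
  "std_simplex n =
     \<lparr>simp = (\<lambda>k. delta_maps k n), act = (\<lambda>l k \<theta> \<sigma>. compose {..l} \<sigma> \<theta>)\<rparr>"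

text \<open>A simplex of \<open>\<Delta>\<^sup>n\<close> lies in the horn iff it lies in the face opposite to some vertex \<open>j \<noteq> i\<close>.\<close>

definition horn :: "nat \<Rightarrow> nat \<Rightarrow> (nat \<Rightarrow> nat) sset" where
  "horn n i =
     \<lparr>simp = (\<lambda>k. {\<sigma> \<in> delta_maps k n. \<exists>j\<le>n. j \<noteq> i \<and> j \<notin> \<sigma> ` {..k}}),
      act = (\<lambda>l k \<theta> \<sigma>. compose {..l} \<sigma> \<theta>)\<rparr>"

definition infinity_category :: "'a sset \<Rightarrow> bool" where
  "infinity_category X \<longleftrightarrow>
     simplicial_set X \<and>
     (\<forall>n i. 0 < i \<longrightarrow> i < n \<longrightarrow>
        (\<forall>g. simplicial_map (horn n i) X g \<longrightarrow>
           (\<exists>h. simplicial_map (std_simplex n) X h \<and>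
                (\<forall>k. \<forall>\<sigma> \<in> simp (horn n i) k. h k \<sigma> = g k \<sigma>))))"


section \<open>The simplicial nerve\<close>

text \<open>The one-dimensional space generated by \<open>(i, j)\<close> is the field itself, with \<open>(i, j)\<close> being \<open>1\<close>.\<close>

definition ainf_simplex :: "nat \<Rightarrow> ('k::field, nat, 'k) ainf" where
  "ainf_simplex n =
     \<lparr>ob = {..n},
      hom = (\<lambda>i j d. if i \<le> j \<and> d = 0 then UNIV else {0}),
      scl = (*),
      opr = (\<lambda>as. if length as = 2 then val (as ! 0) * val (as ! 1) else 0),
      idt = (\<lambda>i. 1)\<rparr>"

text \<open>The functor induced by \<open>\<theta> : [m] \<rightarrow> [n]\<close>; its linear part sends the generator \<open>(i, j)\<close> to
  \<open>(\<theta> i, \<theta> j)\<close>, hence is the identity of the field on coefficients.\<close>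

definition ainf_simplex_map :: "nat \<Rightarrow> (nat \<Rightarrow> nat) \<Rightarrow> (nat, 'k::field, nat, 'k) ainf_fun" where
  "ainf_simplex_map m \<theta> =
     \<lparr>on_ob = restrict \<theta> {..m},
      on_arr = (\<lambda>as. if composable (ainf_simplex m :: ('k, nat, 'k) ainf) as \<and> length as = 1
                     then val (hd as) else 0)\<rparr>"

definition ainf_nerve ::
  "('k::field, 'o, 'v::ab_group_add) ainf \<Rightarrow> (nat, 'k, 'o, 'v) ainf_fun sset" where
  "ainf_nerve A =
     \<lparr>simp = (\<lambda>n. {f. ainf_functor (ainf_simplex n) A f}),
      act = (\<lambda>m n \<theta> f.
        ainf_fun_comp (ainf_simplex m :: ('k, nat, 'k) ainf) f (ainf_simplex_map m \<theta>))\<rparr>"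

end

theory Submission
  imports Defs
begin

text \<open>
  The \<open>A\<^sub>\<infinity>\<close>-category of the \<open>n\<close>-simplex has one-dimensional morphism spaces in degree \<open>0\<close>, its
  only nonzero operation is composition, and its functors into \<open>A\<close> are strictly unital.  Hence such
  a functor amounts to objects \<open>x\<^sub>0, ..., x\<^sub>n\<close> and one element of degree \<open>1 - k\<close> for each chain
  \<open>j\<^sub>0 \<le> ... \<le> j\<^sub>k\<close> in \<open>[n]\<close>, subject to one equation for each chain and to the unit conditions.

  All signs are absorbed by a degree shift.  If the operations of \<open>A\<close> are twisted to \<open>b\<close>
  (\<open>bar_opr\<close>) and the values of the functor on a chain with \<open>k\<close> edges are multiplied by
  \<open>(-1)\<^bsup>k(k-1)/2\<^esup>\<close> to \<open>g\<close> (\<open>chain_val\<close>), the equation for a chain \<open>w\<close> says that its \<open>defect\<close>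
  \<open>E(w) = \<Sum> b(g(w\<^sub>1), ..., g(w\<^sub>p)) + \<Sum>\<^sub>r (-1)\<^sup>r g(\<partial>\<^sub>r w)\<close> is zero; here the first sum runs over
  the ways to cut \<open>w\<close> into consecutive nonempty blocks, and \<open>\<partial>\<^sub>r\<close> removes an interior vertex
  (\<open>inner_face\<close>).  The translation is \<open>functor_equation_defect\<close>.

  The defect of an arbitrary \<open>g\<close> satisfies the identity (\<open>defect_bianchi\<close>)
  \<open>\<Sum> \<plusminus> b(g(w\<^sub>1), ..., E(w\<^sub>k), ..., g(w\<^sub>p)) = \<Sum>\<^sub>r (-1)\<^sup>r E(\<partial>\<^sub>r w)\<close>.
  It is the statement that \<open>F d - d F\<close> anticommutes with the differentials of the bar
  constructions, and follows from the relations of \<open>A\<close> together with the cancellation of the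
  double faces \<open>\<partial>\<^sub>s \<partial>\<^sub>r\<close>.

  Now consider an inner horn.  It prescribes \<open>g\<close> on all chains whose vertices miss some \<open>j \<noteq> i\<close>.
  The nondegenerate chains that are left are the full chain \<open>0 < ... < n\<close> and its face \<open>\<partial>\<close>
  without the vertex \<open>i\<close>.  The filler is \<open>0\<close> on the full chain.  Because \<open>i\<close> is inner,
  \<open>g(\<partial>)\<close> occurs in the defect of the full chain, exactly once and with coefficient \<open>\<plusminus>1\<close>, so its
  value can be chosen such that this defect vanishes (\<open>defect_filler_top\<close>).  In the identity for
  the full chain, every term other than \<open>\<plusminus>E(\<partial>)\<close> is then zero: the proper blocks of the full chain
  miss \<open>0\<close> or \<open>n\<close>, hence lie in the horn, and so do its other inner faces.  Therefore
  \<open>E(\<partial>) = 0\<close> (\<open>defect_filler_missing\<close>).  On degenerate chains the defect vanishes by strict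
  unitality (\<open>defect_degenerate\<close>).  By the Yoneda lemma the resulting functor is the desired map
  out of \<open>\<Delta>\<^sup>n\<close>.
\<close>

section \<open>Cutting lists into blocks\<close>

definition splits :: "'a list \<Rightarrow> 'a list list set" where
  "splits w = {bs. concat bs = w \<and> [] \<notin> set bs}"

lemma concat_blocks: "sum_list is = length w \<Longrightarrow> concat (blocks is w) = w"
  by (induction "is" w rule: blocks.induct) auto

lemma map_length_blocks: "sum_list is = length w \<Longrightarrow> map length (blocks is w) = is"
  by (induction "is" w rule: blocks.induct) auto

lemma blocks_map_length: "blocks (map length bs) (concat bs) = bs"
  by (induction bs) auto

lemma blocks_map: "blocks is (map h w) = map (map h) (blocks is w)"
  by (induction "is" w rule: blocks.induct) (auto simp: take_map drop_map)

lemma blocks_in_splits: "is \<in> compositions (length w) \<Longrightarrow> blocks is w \<in> splits w"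
proof -
  assume a: "is \<in> compositions (length w)"
  then have "sum_list is = length w" "\<forall>i\<in>set is. 1 \<le> i" by (auto simp: compositions_def)
  moreover from this have "\<forall>b\<in>set (blocks is w). length b \<in> set is"
    using map_length_blocks[of "is" w] by (metis image_eqI list.set_map)
  ultimately show ?thesis by (fastforce simp: splits_def concat_blocks)
qed

text \<open>Positive compositions of the length of a list and its cuts into consecutive nonempty blocks are the
same thing; sums over the latter avoid all bookkeeping of indices.\<close>

lemma sum_splits: "sum h (splits w) = (\<Sum>is\<in>compositions (length w). h (blocks is w))"
proof (rule sum.reindex_bij_witness[where i="\<lambda>is. blocks is w" and j="map length"])
  fix bs assume "bs \<in> splits w"
  then have c: "concat bs = w" and n: "[] \<notin> set bs" by (auto simp: splits_def)
  show "blocks (map length bs) w = bs" using c blocks_map_length by blast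
  show "map length bs \<in> compositions (length w)"
    using c n by (auto simp: compositions_def length_concat Suc_le_eq)
  show "h (blocks (map length bs) w) = h bs" using c blocks_map_length by metis
next
  fix "is" assume "is \<in> compositions (length w)"
  then show "map length (blocks is w) = is" "blocks is w \<in> splits w"
    by (auto simp: compositions_def map_length_blocks intro: blocks_in_splits)
qed

lemma finite_splits: "finite (splits w)"
proof (rule finite_subset)
  show "splits w \<subseteq> (\<lambda>is. blocks is w) ` compositions (length w)"
  proof
    fix bs assume "bs \<in> splits w"
    then have "map length bs \<in> compositions (length w)" "bs = blocks (map length bs) w"
      using blocks_map_length[of bs]
      by (auto simp: compositions_def splits_def length_concat Suc_le_eq)
    then show "bs \<in> (\<lambda>is. blocks is w) ` compositions (length w)" by blast
  qed
qed (simp add: finite_compositions)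

definition cuts :: "'a list \<Rightarrow> ('a list \<times> 'a list \<times> 'a list) set" where
  "cuts w = {(us, vs, ws). us @ vs @ ws = w \<and> vs \<noteq> []}"

lemma sum_cuts:
  "(\<Sum>(us, vs, ws)\<in>cuts w. h us vs ws) =
   (\<Sum>(r, s, t)\<in>{(r, s, t). r + s + t = length w \<and> 1 \<le> s}.
      h (take r w) (take s (drop r w)) (drop (r + s) w))"
proof (rule sum.reindex_bij_witness[where
      j="\<lambda>(us, vs, ws). (length us, length vs, length ws)" and
      i="\<lambda>(r, s, t). (take r w, take s (drop r w), drop (r + s) w)"])
  have "take r w @ take s (drop r w) @ drop (r + s) w = w" for r s
    by (metis add.commute append_take_drop_id drop_drop)
  then show "(case z of (r, s, t) \<Rightarrow> (take r w, take s (drop r w), drop (r + s) w)) \<in> cuts w"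
    if "z \<in> {(r, s, t). r + s + t = length w \<and> 1 \<le> s}" for z
    using that by (auto simp: cuts_def)
qed (auto simp: cuts_def Suc_le_eq)

lemma finite_cuts: "finite (cuts w)"
proof (rule finite_subset)
  show "cuts w \<subseteq> (\<lambda>(r, s). (take r w, take s (drop r w), drop (r + s) w)) `
          ({..length w} \<times> {..length w})"
  proof clarify
    fix us vs ws assume "(us, vs, ws) \<in> cuts w"
    then show "(us, vs, ws) \<in> (\<lambda>(r, s). (take r w, take s (drop r w), drop (r + s) w)) `
          ({..length w} \<times> {..length w})"
      by (intro image_eqI[of _ _ "(length us, length vs)"]) (auto simp: cuts_def)
  qed
qed simp

text \<open>A cut into blocks with one distinguished block \<open>v\<close>, the place where an operation or a defect is
inserted.\<close>

definition block_cuts :: "'a list \<Rightarrow> ('a list list \<times> 'a list \<times> 'a list list) set" where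
  "block_cuts w =
     {(us, v, ws). concat us @ v @ concat ws = w \<and> v \<noteq> [] \<and> [] \<notin> set us \<and> [] \<notin> set ws}"

lemma finite_block_cuts: "finite (block_cuts w)"
proof (rule finite_subset)
  show "block_cuts w \<subseteq> (\<lambda>(us, vs, ws). (us, concat vs, ws)) ` (\<Union>bs\<in>splits w. cuts bs)"
  proof clarify
    fix us v ws assume "(us, v, ws) \<in> block_cuts w"
    then have "us @ [v] @ ws \<in> splits w" "(us, [v], ws) \<in> cuts (us @ [v] @ ws)"
      by (auto simp: block_cuts_def splits_def cuts_def)
    then show "(us, v, ws) \<in> (\<lambda>(us, vs, ws). (us, concat vs, ws)) ` (\<Union>bs\<in>splits w. cuts bs)"
      by (intro image_eqI[of _ _ "(us, [v], ws)"]) auto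
  qed
qed (simp add: finite_splits finite_cuts)

text \<open>Cutting the distinguished block once more is the same as cutting the whole list and then bracketing
some consecutive blocks.  This turns double sums of twisted operations into instances of the
\<open>A\<^sub>\<infinity>\<close>-relation.\<close>

lemma sum_block_cuts_splits:
  "(\<Sum>(us, v, ws)\<in>block_cuts w. \<Sum>vs\<in>splits v. h us vs ws) =
   (\<Sum>bs\<in>splits w. \<Sum>(us, vs, ws)\<in>cuts bs. h us vs ws)"
proof -
  have "(\<Sum>(us, v, ws)\<in>block_cuts w. \<Sum>vs\<in>splits v. h us vs ws) =
     (\<Sum>c\<in>block_cuts w. \<Sum>vs\<in>splits (fst (snd c)). h (fst c) vs (snd (snd c)))"
    by (simp add: case_prod_unfold)
  also have "\<dots> = (\<Sum>(c, vs)\<in>(SIGMA c:block_cuts w. splits (fst (snd c))). h (fst c) vs (snd (snd c)))"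
    by (rule sum.Sigma) (auto simp: finite_block_cuts finite_splits)
  also have "\<dots> = (\<Sum>(bs, c)\<in>(SIGMA bs:splits w. cuts bs). h (fst c) (fst (snd c)) (snd (snd c)))"
    by (rule sum.reindex_bij_witness[where
          i="\<lambda>(bs, (us, vs, ws)). ((us, concat vs, ws), vs)" and
          j="\<lambda>((us, v, ws), vs). (us @ vs @ ws, (us, vs, ws))"])
       (auto simp: block_cuts_def splits_def cuts_def simp flip: in_set_conv_decomp, (metis list.set_intros(1) neq_Nil_conv)+)
  also have "\<dots> = (\<Sum>bs\<in>splits w. \<Sum>(us, vs, ws)\<in>cuts bs. h us vs ws)"
    by (subst sum.Sigma[symmetric]) (auto simp: finite_splits finite_cuts case_prod_unfold)
  finally show ?thesis .
qed

section \<open>Signs\<close>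

lemma sgn_pow_add: "sgn_pow (a + b) v = sgn_pow a (sgn_pow b v)"
  by (auto simp: sgn_pow_def)

lemma sgn_pow_cong: "even (a - b) \<Longrightarrow> sgn_pow a v = sgn_pow b v"
  by (auto simp: sgn_pow_def)

lemma sgn_pow_plus: "sgn_pow a (u + v) = sgn_pow a u + sgn_pow a v"
  by (auto simp: sgn_pow_def)

lemma sgn_pow_0 [simp]: "sgn_pow a 0 = 0"
  by (auto simp: sgn_pow_def)

lemma sgn_pow_sum: "sgn_pow a (\<Sum>i\<in>I. f i) = (\<Sum>i\<in>I. sgn_pow a (f i))"
  by (auto simp: sgn_pow_def sum_negf)

lemma sgn_pow_sgn_pow [simp]: "sgn_pow e (sgn_pow e v) = v"
  by (simp add: sgn_pow_def)

section \<open>Inner faces of edge paths\<close>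

text \<open>A path of edges is a list of pairs (source, target) that starts with its last edge, in accordance
with the order of the arguments of \<open>m\<^sub>n\<close>.  Composing the edges at positions \<open>r\<close> and \<open>r + 1\<close> removes
the vertex between them.\<close>

fun inner_face :: "nat \<Rightarrow> ('a \<times> 'a) list \<Rightarrow> ('a \<times> 'a) list" where
  "inner_face 0 (p # q # w) = (fst q, snd p) # w"
| "inner_face (Suc r) (p # w) = p # inner_face r w"
| "inner_face r w = w"

lemma length_inner_face: "Suc r < length w \<Longrightarrow> length (inner_face r w) = length w - 1"
  by (induction r w rule: inner_face.induct) auto

lemma inner_face_inner_face:
  "r \<le> s \<Longrightarrow> Suc (Suc s) < length w \<Longrightarrow>
   inner_face s (inner_face r w) = inner_face r (inner_face (Suc s) w)"
proof (induction r w arbitrary: s rule: inner_face.induct)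
  case (1 p q w)
  then show ?case by (cases s; cases w) auto
next
  case (2 r p w)
  then show ?case by (cases s) auto
qed auto

lemma inner_face_append:
  "Suc r < length v \<Longrightarrow> inner_face (length u + r) (u @ v @ w) = u @ inner_face r v @ w"
proof (induction u)
  case Nil
  then show ?case by (induction r v rule: inner_face.induct) auto
qed simp

text \<open>A block of a face that contains the composite edge comes from a block of the original path.\<close>

lemma inner_face_eq_appendD:
  assumes "inner_face r w = a @ b @ c" "length a \<le> r" "r < length a + length b" "Suc r < length w"
  shows "\<exists>v. w = a @ v @ c \<and> b = inner_face (r - length a) v \<and> Suc (r - length a) < length v"
  using assms
proof (induction a arbitrary: r w)
  case Nil
  then have "inner_face r w = b @ c" "r < length b" "Suc r < length w" by auto
  then show ?case
  proof (induction r w arbitrary: b rule: inner_face.induct)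
    case (1 p q w)
    then obtain b' where "b = (fst q, snd p) # b'" "w = b' @ c" by (cases b) auto
    then show ?case by (intro exI[of _ "p # q # b'"]) auto
  next
    case (2 r p w)
    then obtain b' where b: "b = p # b'" "inner_face r w = b' @ c" by (cases b) auto
    from 2 b obtain v where "w = v @ c" "b' = inner_face r v" "Suc r < length v" by fastforce
    with b show ?case by (intro exI[of _ "p # v"]) auto
  qed (auto simp: Cons_eq_append_conv)
next
  case (Cons e a)
  then obtain r' where r: "r = Suc r'" by (cases r) auto
  from Cons.prems r obtain w' where w: "w = e # w'" "inner_face r' w' = a @ b @ c"
    by (cases w) auto
  with Cons.IH[of r' w'] Cons.prems r show ?case by auto
qed

lemma concat_position:
  "r < length (concat bs) \<Longrightarrow>
   \<exists>us b ws. bs = us @ b # ws \<and> length (concat us) \<le> r \<and> r < length (concat us) + length b"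
proof (induction bs arbitrary: r)
  case (Cons c bs)
  show ?case
  proof (cases "r < length c")
    case True
    then show ?thesis by (intro exI[of _ "[]"] exI[of _ c] exI[of _ bs]) auto
  next
    case False
    with Cons.prems have "r - length c < length (concat bs)" by auto
    from Cons.IH[OF this] obtain us b ws where "bs = us @ b # ws"
      "length (concat us) \<le> r - length c" "r - length c < length (concat us) + length b" by blast
    with False show ?thesis by (intro exI[of _ "c # us"] exI[of _ b] exI[of _ ws]) auto
  qed
qed simp

lemma concat_position_unique:
  assumes "us @ b # ws = us' @ b' # ws'"
    and "length (concat us) \<le> r" "r < length (concat us) + length b"
    and "length (concat us') \<le> r" "r < length (concat us') + length b'"
  shows "us = us' \<and> b = b' \<and> ws = ws'"
proof -
  have "(\<exists>zs. us = us' @ b' # zs) \<or> (\<exists>zs. us' = us @ b # zs) \<or> us = us'"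
    using assms(1) by (auto simp: append_eq_append_conv2 append_eq_Cons_conv Cons_eq_append_conv)
  then show ?thesis using assms by auto
qed

text \<open>Composing two edges inside a block and then forgetting which block it was, or first composing the two
edges and then cutting, gives the same cuts: the position of the composite edge determines its block.\<close>

lemma sum_block_cuts_inner_face:
  "(\<Sum>(us, v, ws)\<in>block_cuts w. \<Sum>r<length v - 1.
      h (length (concat us) + r) (us @ inner_face r v # ws)) =
   (\<Sum>r<length w - 1. \<Sum>bs\<in>splits (inner_face r w). h r bs)"
proof -
  let ?X = "SIGMA c:block_cuts w. {..<length (fst (snd c)) - 1}"
  let ?Y = "SIGMA r:{..<length w - 1}. splits (inner_face r w)"
  let ?j = "\<lambda>((us, v, ws), r). (length (concat us) + r, us @ inner_face r v # ws)"
  have "inj_on ?j ?X"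
  proof (rule inj_onI)
    fix z z' assume "z \<in> ?X" "z' \<in> ?X" "?j z = ?j z'"
    moreover obtain us v ws r where "z = ((us, v, ws), r)" by (metis prod.collapse)
    moreover obtain us' v' ws' r' where "z' = ((us', v', ws'), r')" by (metis prod.collapse)
    ultimately have a: "(us, v, ws) \<in> block_cuts w" "(us', v', ws') \<in> block_cuts w"
      "Suc r < length v" "Suc r' < length v'"
      "length (concat us) + r = length (concat us') + r'"
      "us @ inner_face r v # ws = us' @ inner_face r' v' # ws'"
      and z: "z = ((us, v, ws), r)" "z' = ((us', v', ws'), r')"
      by auto
    have "us = us' \<and> inner_face r v = inner_face r' v' \<and> ws = ws'"
      by (rule concat_position_unique[OF a(6), of "length (concat us) + r"])
         (use a in \<open>auto simp: length_inner_face\<close>)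
    with a z show "z = z'" by (auto simp: block_cuts_def)
  qed
  moreover have "?j ` ?X = ?Y"
  proof (intro equalityI subsetI)
    fix y assume "y \<in> ?j ` ?X"
    then obtain us v ws r where a: "(us, v, ws) \<in> block_cuts w" "Suc r < length v"
      and y: "y = (length (concat us) + r, us @ inner_face r v # ws)"
      by (auto simp: less_diff_conv)
    from a have w: "w = concat us @ v @ concat ws" by (auto simp: block_cuts_def)
    have "inner_face r v \<noteq> []" using a length_inner_face[of r v] by auto
    then show "y \<in> ?Y" unfolding y
      using a by (auto simp: splits_def w inner_face_append block_cuts_def)
  next
    fix y assume "y \<in> ?Y"
    then obtain r bs where y: "y = (r, bs)" and r: "Suc r < length w"
      and c: "concat bs = inner_face r w" and n: "[] \<notin> set bs"
      by (auto simp: splits_def)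
    have "r < length (concat bs)" using r c by (simp add: length_inner_face)
    from concat_position[OF this] obtain us b ws where b: "bs = us @ b # ws"
      "length (concat us) \<le> r" "r < length (concat us) + length b" by blast
    from inner_face_eq_appendD[of r w "concat us" b "concat ws"] b c r obtain v where
      "w = concat us @ v @ concat ws" "b = inner_face (r - length (concat us)) v"
      "Suc (r - length (concat us)) < length v" by auto
    then show "y \<in> ?j ` ?X" using b n y
      by (intro image_eqI[of _ _ "((us, v, ws), r - length (concat us))"])
         (auto simp: block_cuts_def)
  qed
  ultimately have bij: "bij_betw ?j ?X ?Y" by (simp add: bij_betw_def)
  have "(\<Sum>(us, v, ws)\<in>block_cuts w. \<Sum>r<length v - 1.
      h (length (concat us) + r) (us @ inner_face r v # ws)) =
      (\<Sum>c\<in>block_cuts w. \<Sum>r<length (fst (snd c)) - 1. case_prod h (?j (c, r)))"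
    by (simp add: case_prod_unfold)
  also have "\<dots> = (\<Sum>(c, r)\<in>?X. case_prod h (?j (c, r)))"
    by (rule sum.Sigma) (auto simp: finite_block_cuts)
  also have "\<dots> = (\<Sum>z\<in>?X. case_prod h (?j z))"
    by (rule sum.cong) auto
  also have "\<dots> = sum (case_prod h) ?Y"
    by (rule sum.reindex_bij_betw[OF bij])
  also have "\<dots> = (\<Sum>r<length w - 1. \<Sum>bs\<in>splits (inner_face r w). h r bs)"
    by (rule sum.Sigma[symmetric]) (auto simp: finite_splits)
  finally show ?thesis .
qed

text \<open>The simplicial identity \<open>\<partial>\<^sub>s \<partial>\<^sub>r = \<partial>\<^sub>r \<partial>\<^bsub>s+1\<^esub>\<close> for \<open>r \<le> s\<close> pairs off the double faces with opposite signs.\<close>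

lemma inner_faces_cancel:
  "(\<Sum>r<length w - 1. \<Sum>s<length w - 2.
      sgn_pow (int r) (sgn_pow (int s) (g (inner_face s (inner_face r w))))) = (0::'v::ab_group_add)"
  (is "?S = 0")
proof -
  let ?n = "length w"
  let ?f = "\<lambda>r s. sgn_pow (int r + int s) (g (inner_face s (inner_face r w)))"
  let ?U = "{(r, s). r < ?n - 1 \<and> s < ?n - 2 \<and> r \<le> s}"
  let ?L = "{(r, s). r < ?n - 1 \<and> s < ?n - 2 \<and> s < r}"
  have fin: "finite ?U" "finite ?L"
    by (rule finite_subset[of _ "{..?n} \<times> {..?n}"]; auto)+
  have "?S = (\<Sum>(r, s)\<in>{..<?n - 1} \<times> {..<?n - 2}. ?f r s)"
    by (simp add: sum.cartesian_product sgn_pow_add)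
  also have "{..<?n - 1} \<times> {..<?n - 2} = ?U \<union> ?L" by auto
  also have "(\<Sum>(r, s)\<in>?U \<union> ?L. ?f r s) = (\<Sum>(r, s)\<in>?U. ?f r s) + (\<Sum>(r, s)\<in>?L. ?f r s)"
    by (rule sum.union_disjoint) (use fin in auto)
  also have "(\<Sum>(r, s)\<in>?U. ?f r s) = (\<Sum>(r, s)\<in>?L. - ?f r s)"
    by (rule sum.reindex_bij_witness[where i="\<lambda>(r, s). (s, r - 1)" and j="\<lambda>(r, s). (Suc s, r)"])
       (auto simp: inner_face_inner_face sgn_pow_def)
  finally show ?thesis by (simp add: sum_negf case_prod_unfold)
qed

section \<open>Multilinear maps on composable lists\<close>

lemma composable_append:
  assumes "us \<noteq> []" "vs \<noteq> []"
  shows "composable A (us @ vs) \<longleftrightarrow>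
    composable A us \<and> composable A vs \<and> src (last us) = tgt (hd vs)"
  using assms by (auto simp: composable_def successively_append_iff)

lemma composable_singleton [simp]: "composable A [a] \<longleftrightarrow> is_arr A a"
  by (simp add: composable_def)

lemma composable_replace:
  assumes "composable A (us @ vs @ ws)" "vs \<noteq> []" "is_arr A a"
    "src a = src (last vs)" "tgt a = tgt (hd vs)"
  shows "composable A (us @ a # ws)"
  using assms by (auto simp: composable_def successively_append_iff successively_Cons)

lemma composable_replace1:
  assumes "composable A (us @ a # ws)" "is_arr A b" "src b = src a" "tgt b = tgt a"
  shows "composable A (us @ b # ws)"
  using composable_replace[of A us "[a]" ws b] assms by auto

lemma composable_infix: "composable A (us @ vs @ ws) \<Longrightarrow> vs \<noteq> [] \<Longrightarrow> composable A vs"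
  by (auto simp: composable_def successively_append_iff)

locale graded_space =
  fixes A :: "('k::field, 'o, 'v::ab_group_add) ainf"
  assumes vector_space_scl: "vector_space (scl A)"
    and subspace_hom: "x \<in> ob A \<Longrightarrow> y \<in> ob A \<Longrightarrow> module.subspace (scl A) (hom A x y d)"

sublocale graded_space \<subseteq> vs: vector_space "scl A"
  by (rule vector_space_scl)

sublocale ainf_category \<subseteq> graded_space A
  by (rule graded_space.intro) (rule vector_space_scl, rule subspace_hom)

context graded_space
begin

lemma hom_0: "x \<in> ob A \<Longrightarrow> y \<in> ob A \<Longrightarrow> 0 \<in> hom A x y d"
  using subspace_hom vs.subspace_0 by blast

lemma hom_add:
  "x \<in> ob A \<Longrightarrow> y \<in> ob A \<Longrightarrow> u \<in> hom A x y d \<Longrightarrow> v \<in> hom A x y d \<Longrightarrow> u + v \<in> hom A x y d"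
  using subspace_hom vs.subspace_add by blast

lemma hom_scl: "x \<in> ob A \<Longrightarrow> y \<in> ob A \<Longrightarrow> u \<in> hom A x y d \<Longrightarrow> scl A c u \<in> hom A x y d"
  using subspace_hom vs.subspace_scale by blast

lemma hom_sum:
  "x \<in> ob A \<Longrightarrow> y \<in> ob A \<Longrightarrow> (\<And>i. i \<in> I \<Longrightarrow> f i \<in> hom A x y d) \<Longrightarrow> sum f I \<in> hom A x y d"
  using subspace_hom vs.subspace_sum by blast

lemma sgn_pow_scl: "sgn_pow e v = scl A (if even e then 1 else - 1) v"
  by (auto simp: sgn_pow_def)

lemma hom_sgn_pow:
  "x \<in> ob A \<Longrightarrow> y \<in> ob A \<Longrightarrow> u \<in> hom A x y d \<Longrightarrow> sgn_pow e u \<in> hom A x y d"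
  by (simp add: sgn_pow_scl hom_scl)

lemma scl_sgn_pow: "scl A c (sgn_pow e v) = sgn_pow e (scl A c v)"
  by (auto simp: sgn_pow_def)

end

definition scale :: "('k, 'o, 'v) ainf \<Rightarrow> 'k \<Rightarrow> ('o, 'v) harr \<Rightarrow> ('o, 'v) harr" where
  "scale A c a = Harr (src a) (tgt a) (deg a) (scl A c (val a))"

lemma scale_simps [simp]:
  "src (scale A c a) = src a" "tgt (scale A c a) = tgt a" "deg (scale A c a) = deg a"
  "val (scale A c a) = scl A c (val a)"
  by (auto simp: scale_def)

lemma (in graded_space) is_arr_scale: "is_arr A a \<Longrightarrow> is_arr A (scale A c a)"
  by (auto simp: is_arr_def hom_scl)

lemma multilinear_scale_list:
  assumes "graded_space A" "graded_multilinear A B p d F" "vector_space (scl B)"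
    and "composable A (us @ map snd zs)"
  shows "F (us @ map (\<lambda>(c, a). scale A c a) zs) =
    scl B (prod_list (map fst zs)) (F (us @ map snd zs))"
  using assms(4)
proof (induction zs arbitrary: us)
  case Nil
  interpret B: vector_space "scl B" by (fact assms(3))
  show ?case by simp
next
  case (Cons z zs)
  interpret A: graded_space A by (fact assms(1))
  interpret B: vector_space "scl B" by (fact assms(3))
  obtain c a where z: "z = (c, a)" by (cases z)
  have comp: "composable A (us @ a # map snd zs)" using Cons.prems z by simp
  then have "is_arr A a" by (auto simp: composable_def)
  then have "composable A ((us @ [scale A c a]) @ map snd zs)"
    using composable_replace1[OF comp] by (simp add: A.is_arr_scale)
  from Cons.IH[OF this]
  have "F (us @ scale A c a # map (\<lambda>(c, a). scale A c a) zs) =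
      scl B (prod_list (map fst zs)) (F (us @ scale A c a # map snd zs))"
    by simp
  also have "F (us @ scale A c a # map snd zs) = scl B c (F (us @ a # map snd zs))"
    using assms(2) comp unfolding graded_multilinear_def scale_def
    by (cases a) auto
  finally show ?case using z by (simp add: mult.commute)
qed

text \<open>Zero morphisms may carry any degree tag and, in the simplex, any pair of endpoints; this lemma
disposes of the terms in which they occur.\<close>

lemma multilinear_zero:
  assumes "graded_space A" "graded_multilinear A B p d F" "vector_space (scl B)"
    and "composable A as" "a \<in> set as" "val a = 0"
  shows "F as = 0"
proof -
  interpret A: graded_space A by (fact assms(1))
  interpret B: vector_space "scl B" by (fact assms(3))
  obtain us ws where as: "as = us @ a # ws" using assms(5) by (auto simp: in_set_conv_decomp)
  moreover obtain x y e where a: "a = Harr x y e 0" using assms(6) by (cases a) auto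
  ultimately have "F (us @ Harr x y e (scl A 0 0) # ws) = scl B 0 (F (us @ Harr x y e 0 # ws))"
    using assms(2,4) unfolding graded_multilinear_def by blast
  then show ?thesis using as a by simp
qed

section \<open>The operations after the degree shift\<close>

text \<open>On \<open>a\<^sub>1 \<otimes> ... \<otimes> a\<^sub>n\<close> (in the order of the list) the exponent is \<open>\<Sum>\<^sub>k (n - k) (deg a\<^sub>k - 1)\<close>, the
Koszul sign of the \<open>n\<close>-fold tensor power of the suspension.\<close>

fun shift_exp :: "('o, 'v) harr list \<Rightarrow> int" where
  "shift_exp [] = 0"
| "shift_exp (a # as) = int (length as) * (deg a - 1) + shift_exp as"

lemma shift_exp_cong: "map deg as = map deg bs \<Longrightarrow> shift_exp as = shift_exp bs"
  by (induction as arbitrary: bs) (auto simp: Cons_eq_map_conv dest: map_eq_imp_length_eq)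

text \<open>The total degree after suspension.\<close>

definition redeg :: "('o, 'v) harr list \<Rightarrow> int" where
  "redeg as = degsum as - int (length as)"

lemma redeg_simps [simp]: "redeg [] = 0" "redeg (a # as) = deg a - 1 + redeg as"
  "redeg (as @ bs) = redeg as + redeg bs"
  by (auto simp: redeg_def degsum_def)

lemma shift_exp_append:
  "shift_exp (as @ bs) = shift_exp as + int (length bs) * redeg as + shift_exp bs"
  by (induction as) (auto simp: algebra_simps)

text \<open>The components of the differential of the bar construction, which all have degree \<open>1\<close> with respect to
\<open>redeg\<close>.\<close>

definition bar_opr :: "('k, 'o, 'v::ab_group_add) ainf \<Rightarrow> ('o, 'v) harr list \<Rightarrow> 'v" where
  "bar_opr A as = sgn_pow (shift_exp as) (opr A as)"

context ainf_category
begin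

lemma bar_opr_hom:
  assumes "composable A as"
  shows "bar_opr A as \<in> hom A (src (last as)) (tgt (hd as)) (redeg as + 2)"
proof -
  have "is_arr A (arr_of id 2 (opr A) as)"
    using opr_multilinear assms by (auto simp: graded_multilinear_def)
  then show ?thesis
    by (auto simp: is_arr_def arr_of_def bar_opr_def redeg_def hom_sgn_pow algebra_simps)
qed

lemma bar_opr_zero:
  "composable A as \<Longrightarrow> a \<in> set as \<Longrightarrow> val a = 0 \<Longrightarrow> bar_opr A as = 0"
  using multilinear_zero[OF graded_space_axioms opr_multilinear vector_space_scl, of as a]
  by (simp add: bar_opr_def)

lemma bar_opr_add:
  assumes "composable A (us @ Harr x y e u # ws)" "composable A (us @ Harr x y e v # ws)"
  shows "bar_opr A (us @ Harr x y e (u + v) # ws) =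
    bar_opr A (us @ Harr x y e u # ws) + bar_opr A (us @ Harr x y e v # ws)"
  using opr_multilinear assms unfolding graded_multilinear_def bar_opr_def
  by (auto simp: shift_exp_append redeg_def degsum_def sgn_pow_plus)

lemma opr_sgn_pow:
  assumes "composable A (us @ Harr x y e u # ws)"
  shows "opr A (us @ Harr x y e (sgn_pow i u) # ws) = sgn_pow i (opr A (us @ Harr x y e u # ws))"
  using opr_multilinear assms unfolding graded_multilinear_def
  by (simp add: sgn_pow_scl)

lemma bar_opr_sgn_pow:
  assumes "composable A (us @ Harr x y e u # ws)"
  shows "bar_opr A (us @ Harr x y e (sgn_pow i u) # ws) =
    sgn_pow i (bar_opr A (us @ Harr x y e u # ws))"
  using opr_sgn_pow[OF assms] unfolding bar_opr_def
  by (auto simp: shift_exp_append redeg_def degsum_def sgn_pow_def)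

lemma bar_opr_sum:
  assumes "finite I" "composable A (us @ Harr x y e 0 # ws)"
    and "\<And>i. i \<in> I \<Longrightarrow> f i \<in> hom A x y e"
  shows "bar_opr A (us @ Harr x y e (\<Sum>i\<in>I. f i) # ws) =
    (\<Sum>i\<in>I. bar_opr A (us @ Harr x y e (f i) # ws))"
  using assms(1,3)
proof (induction I rule: finite_induct)
  case empty
  then show ?case using bar_opr_zero[OF assms(2), of "Harr x y e 0"] by simp
next
  case (insert j I)
  have ob: "x \<in> ob A" "y \<in> ob A" using assms(2) by (auto simp: composable_def is_arr_def)
  have c: "composable A (us @ Harr x y e v # ws)" if "v \<in> hom A x y e" for v
    by (rule composable_replace1[OF assms(2)]) (use that ob in \<open>auto simp: is_arr_def\<close>)
  show ?case using insert
    by (simp add: bar_opr_add c hom_sum ob)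
qed

text \<open>After the shift, the only sign left in the \<open>A\<^sub>\<infinity>\<close>-relation is the Koszul sign of moving an operation of
degree \<open>1\<close> past the first arguments.\<close>

lemma bar_relation:
  assumes "composable A as"
  shows "(\<Sum>(us, vs, ws)\<in>cuts as.
    sgn_pow (redeg us) (bar_opr A (us @ arr_of id 2 (bar_opr A) vs # ws))) = 0"
proof -
  let ?m = "\<lambda>us vs ws. opr A (us @ arr_of id 2 (opr A) vs # ws)"
  let ?e = "\<lambda>us vs ws. int (length vs) * int (length us) + int (length ws) +
    (2 - int (length vs)) * degsum us"
  have "sgn_pow (redeg us) (bar_opr A (us @ arr_of id 2 (bar_opr A) vs # ws)) =
      sgn_pow (shift_exp as) (sgn_pow (?e us vs ws) (?m us vs ws))"
    if "(us, vs, ws) \<in> cuts as" for us vs ws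
  proof -
    from that have as: "as = us @ vs @ ws" and vs: "vs \<noteq> []" by (auto simp: cuts_def)
    let ?a = "arr_of id 2 (opr A) vs"
    have "is_arr A ?a"
      using opr_multilinear composable_infix[of A us vs ws] assms as vs
      by (auto simp: graded_multilinear_def)
    then have c: "composable A (us @ ?a # ws)"
      using assms as vs by (intro composable_replace[of A us vs ws]) (auto simp: arr_of_def)
    have m: "opr A (us @ arr_of id 2 (bar_opr A) vs # ws) = sgn_pow (shift_exp vs) (?m us vs ws)"
      using opr_sgn_pow[OF c[unfolded arr_of_def]] by (simp add: arr_of_def bar_opr_def)
    have "shift_exp (us @ arr_of id 2 (bar_opr A) vs # ws) =
        shift_exp us + (1 + int (length ws)) * redeg us + int (length ws) * (redeg vs + 1) +
        shift_exp ws"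
      by (simp add: shift_exp_append arr_of_def redeg_def)
    \<comment> \<open>The exponents before and after the shift differ by \<open>2 * length us\<close>.\<close>
    then have "redeg us + shift_exp (us @ arr_of id 2 (bar_opr A) vs # ws) + shift_exp vs -
        (shift_exp as + ?e us vs ws) =
        2 * (redeg us - degsum us) + int (length vs) * (degsum us - int (length us) - redeg us)"
      unfolding as by (simp add: shift_exp_append algebra_simps)
    also have "\<dots> = - 2 * int (length us)" by (simp add: redeg_def)
    finally have "even (redeg us + shift_exp (us @ arr_of id 2 (bar_opr A) vs # ws) + shift_exp vs -
        (shift_exp as + ?e us vs ws))" by simp
    from sgn_pow_cong[OF this]
    show ?thesis by (simp add: bar_opr_def[of A "us @ _ # ws"] m sgn_pow_add)
  qed
  then have "(\<Sum>(us, vs, ws)\<in>cuts as.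
      sgn_pow (redeg us) (bar_opr A (us @ arr_of id 2 (bar_opr A) vs # ws))) =
      sgn_pow (shift_exp as) (\<Sum>(us, vs, ws)\<in>cuts as. sgn_pow (?e us vs ws) (?m us vs ws))"
    by (auto simp: sgn_pow_sum intro!: sum.cong)
  also have "(\<Sum>(us, vs, ws)\<in>cuts as. sgn_pow (?e us vs ws) (?m us vs ws)) =
      insertion_sum A (opr A) as"
    unfolding insertion_sum_def sum_cuts
    by (rule sum.cong) (auto intro!: arg_cong2[of _ _ _ _ sgn_pow])
  finally show ?thesis by (simp only: ainf_relation[OF assms] sgn_pow_0)
qed

text \<open>Identities are cycles: the relation for the pair \<open>(1, 1)\<close> reads \<open>m\<^sub>1(1) = m\<^sub>1(1) + m\<^sub>1(1)\<close>.\<close>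

lemma bar_opr_idt: "x \<in> ob A \<Longrightarrow> bar_opr A [id_arr A x] = 0"
proof -
  assume x: "x \<in> ob A"
  let ?i = "id_arr A x"
  have i: "is_arr A ?i" using x idt_in_hom by (auto simp: is_arr_def id_arr_def)
  have c: "composable A [?i, ?i]" using i by (auto simp: composable_def id_arr_def)
  let ?d = "arr_of id 2 (opr A) [?i]"
  have d: "is_arr A ?d" using opr_multilinear i by (auto simp: graded_multilinear_def)
  have st: "src ?d = x" "tgt ?d = x" "val ?d = opr A [?i]"
    by (auto simp: arr_of_def id_arr_def)
  have "{(r, s, t). r + s + t = length [?i, ?i] \<and> 1 \<le> s} = {(0, 1, 1), (1, 1, 0), (0, 2, 0::nat)}"
    by auto
  then have "insertion_sum A (opr A) [?i, ?i] =
      - opr A [?d, ?i] + (- opr A [?i, ?d] + opr A [arr_of id 2 (opr A) [?i, ?i]])"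
    by (simp add: insertion_sum_def sgn_pow_def degsum_def id_arr_def)
  moreover have "opr A [?d, ?i] = opr A [?i]" "opr A [?i, ?d] = opr A [?i]"
    using opr_id_left[OF d] opr_id_right[OF d] st by simp_all
  moreover have "arr_of id 2 (opr A) [?i, ?i] = ?i"
    using opr_id_left[OF i] by (simp add: arr_of_def degsum_def id_arr_def)
  ultimately show ?thesis using ainf_relation[OF c] by (simp add: bar_opr_def)
qed

end

section \<open>Chains and the defect of the functor equation\<close>

definition chain :: "nat \<Rightarrow> (nat \<times> nat) list \<Rightarrow> bool" where
  "chain n w \<longleftrightarrow> w \<noteq> [] \<and> (\<forall>(i, j)\<in>set w. i \<le> j \<and> j \<le> n) \<and>
     successively (\<lambda>p q. fst p = snd q) w"

lemma chain_append:
  "us \<noteq> [] \<Longrightarrow> vs \<noteq> [] \<Longrightarrow>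
   chain n (us @ vs) \<longleftrightarrow> chain n us \<and> chain n vs \<and> fst (last us) = snd (hd vs)"
  by (auto simp: chain_def successively_append_iff)

lemma chain_infix: "chain n (us @ vs @ ws) \<Longrightarrow> vs \<noteq> [] \<Longrightarrow> chain n vs"
  by (auto simp: chain_def successively_append_iff)

lemma chain_edge: "chain n w \<Longrightarrow> e \<in> set w \<Longrightarrow> fst e \<le> snd e \<and> snd e \<le> n"
  by (auto simp: chain_def)

lemma chain_ends:
  assumes "chain n w"
  shows "fst (last w) \<le> n" "snd (hd w) \<le> n"
proof -
  from assms have "hd w \<in> set w" "last w \<in> set w" by (auto simp: chain_def)
  with chain_edge[OF assms] show "fst (last w) \<le> n" "snd (hd w) \<le> n"
    using order_trans by blast+
qed

lemma chain_block: "chain n (concat bs) \<Longrightarrow> b \<in> set bs \<Longrightarrow> b \<noteq> [] \<Longrightarrow> chain n b"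
  by (auto simp: in_set_conv_decomp intro: chain_infix[of n "concat _"])

lemma inner_face_ends:
  assumes "Suc r < length w"
  shows "fst (last (inner_face r w)) = fst (last w)" "snd (hd (inner_face r w)) = snd (hd w)"
    "inner_face r w \<noteq> []"
proof -
  show ne: "inner_face r w \<noteq> []" using assms length_inner_face[of r w] by auto
  show "fst (last (inner_face r w)) = fst (last w)"
    using assms
  proof (induction r w rule: inner_face.induct)
    case (2 r p w)
    moreover from this have "inner_face r w \<noteq> []" using length_inner_face[of r w] by auto
    ultimately show ?case by (cases w) auto
  qed auto
  show "snd (hd (inner_face r w)) = snd (hd w)"
    using assms by (induction r w rule: inner_face.induct) auto
qed

lemma chain_inner_face:
  assumes "chain n w" "Suc r < length w"
  shows "chain n (inner_face r w)"
  using assms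
proof (induction r w rule: inner_face.induct)
  case (1 p q w)
  then show ?case by (cases w) (auto simp: chain_def)
next
  case (2 r p w)
  then have r: "Suc r < length w" by simp
  then have "w \<noteq> []" by auto
  with 2 have "chain n [p]" "chain n w" "fst p = snd (hd w)"
    using chain_append[of "[p]" w n] by auto
  then show ?case using 2(1) r inner_face_ends[OF r] chain_append[of "[p]" "inner_face r w" n]
    by auto
qed auto

text \<open>The morphism of \<open>A\<close> that a functor with object map \<open>x\<close> and values \<open>g\<close> assigns to a chain.\<close>

definition garr :: "(nat \<Rightarrow> 'o) \<Rightarrow> ((nat \<times> nat) list \<Rightarrow> 'v) \<Rightarrow> (nat \<times> nat) list \<Rightarrow> ('o, 'v) harr"
  where "garr x g w = Harr (x (fst (last w))) (x (snd (hd w))) (1 - int (length w)) (g w)"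

lemma garr_simps [simp]:
  "src (garr x g w) = x (fst (last w))" "tgt (garr x g w) = x (snd (hd w))"
  "deg (garr x g w) = 1 - int (length w)" "val (garr x g w) = g w"
  by (auto simp: garr_def)

lemma redeg_garrs: "redeg (map (garr x g) bs) = - int (length (concat bs))"
  by (induction bs) auto

text \<open>The failure of the functor equation on a chain; the first sum is the contribution of the operations
of \<open>A\<close>, the second one that of the composition in the simplex.\<close>

definition defect ::
  "('k, 'o, 'v::ab_group_add) ainf \<Rightarrow> (nat \<Rightarrow> 'o) \<Rightarrow> ((nat \<times> nat) list \<Rightarrow> 'v) \<Rightarrow>
   (nat \<times> nat) list \<Rightarrow> 'v" where
  "defect A x g w =
     (\<Sum>bs\<in>splits w. bar_opr A (map (garr x g) bs)) +
     (\<Sum>r<length w - 1. sgn_pow (int r) (g (inner_face r w)))"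

lemma defect_cong:
  assumes "chain n w" "\<And>j. j \<le> n \<Longrightarrow> x j = x' j"
    and "\<And>bs b. bs \<in> splits w \<Longrightarrow> b \<in> set bs \<Longrightarrow> g b = g' b"
    and "\<And>r. Suc r < length w \<Longrightarrow> g (inner_face r w) = g' (inner_face r w)"
  shows "defect A x g w = defect A x' g' w"
proof -
  have "map (garr x g) bs = map (garr x' g') bs" if bs: "bs \<in> splits w" for bs
  proof (rule map_cong)
    fix b assume b: "b \<in> set bs"
    with bs assms(1) have "chain n b" by (auto simp: splits_def intro: chain_block)
    then show "garr x g b = garr x' g' b"
      using assms(2,3) bs b chain_ends[of n b] by (simp add: garr_def)
  qed simp
  then have "(\<Sum>bs\<in>splits w. bar_opr A (map (garr x g) bs)) =
      (\<Sum>bs\<in>splits w. bar_opr A (map (garr x' g') bs))"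
    by (intro sum.cong refl arg_cong[of _ _ "bar_opr A"])
  then show ?thesis using assms(4) by (simp add: defect_def)
qed

lemma last_concat_last: "bs \<noteq> [] \<Longrightarrow> [] \<notin> set bs \<Longrightarrow> last (concat bs) = last (last bs)"
  by (cases bs rule: rev_cases) auto

locale simplex_data = ainf_category A
  for A :: "('k::field, 'o, 'v::ab_group_add) ainf" +
  fixes n :: nat and x :: "nat \<Rightarrow> 'o" and g :: "(nat \<times> nat) list \<Rightarrow> 'v"
  assumes x_ob: "j \<le> n \<Longrightarrow> x j \<in> ob A"
    and g_hom: "chain n w \<Longrightarrow> g w \<in> hom A (x (fst (last w))) (x (snd (hd w))) (1 - int (length w))"
begin

lemma ends_ob: "chain n w \<Longrightarrow> x (fst (last w)) \<in> ob A" "chain n w \<Longrightarrow> x (snd (hd w)) \<in> ob A"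
  using chain_ends x_ob by blast+

lemma is_arr_garr: "chain n w \<Longrightarrow> is_arr A (garr x g w)"
  by (simp add: is_arr_def ends_ob g_hom)

lemma composable_garrs:
  "chain n (concat bs) \<Longrightarrow> [] \<notin> set bs \<Longrightarrow> composable A (map (garr x g) bs)"
proof (induction bs)
  case (Cons b bs)
  show ?case
  proof (cases "bs = []")
    case True
    then show ?thesis using Cons by (simp add: is_arr_garr)
  next
    case False
    then have "b \<noteq> []" "concat bs \<noteq> []" "hd (concat bs) = hd (hd bs)"
      using Cons.prems by (cases bs; force)+
    then have "chain n b" "chain n (concat bs)" "fst (last b) = snd (hd (hd bs))"
      using Cons.prems chain_append[of b "concat bs" n] by auto
    moreover have "composable A (map (garr x g) bs)" using Cons calculation by auto
    ultimately show ?thesis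
      using False composable_append[of "[garr x g b]" "map (garr x g) bs" A]
      by (simp add: is_arr_garr hd_map)
  qed
qed (simp add: chain_def)

lemma bar_garrs:
  assumes "chain n w" "bs \<in> splits w"
  shows "arr_of id 2 (bar_opr A) (map (garr x g) bs) =
      Harr (x (fst (last w))) (x (snd (hd w))) (2 - int (length w)) (bar_opr A (map (garr x g) bs))"
    and "bar_opr A (map (garr x g) bs) \<in>
      hom A (x (fst (last w))) (x (snd (hd w))) (2 - int (length w))"
proof -
  have bs: "concat bs = w" "[] \<notin> set bs" using assms(2) by (auto simp: splits_def)
  then have "bs \<noteq> []" using assms(1) by (auto simp: chain_def)
  moreover have "hd bs \<noteq> []" using bs(2) hd_in_set[OF calculation] by auto
  ultimately have *: "last (map (garr x g) bs) = garr x g (last bs)"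
    "hd (map (garr x g) bs) = garr x g (hd bs)"
    "last (last bs) = last w" "hd (hd bs) = hd w"
    using bs last_concat_last[of bs] hd_concat[of bs] by (auto simp: last_map hd_map)
  have "degsum (map (garr x g) bs) - int (length bs) = - int (length w)"
    using redeg_garrs[of x g bs] bs by (simp add: redeg_def)
  then show "arr_of id 2 (bar_opr A) (map (garr x g) bs) =
      Harr (x (fst (last w))) (x (snd (hd w))) (2 - int (length w)) (bar_opr A (map (garr x g) bs))"
    using * by (simp add: arr_of_def)
  show "bar_opr A (map (garr x g) bs) \<in>
      hom A (x (fst (last w))) (x (snd (hd w))) (2 - int (length w))"
    using bar_opr_hom[OF composable_garrs, of bs] assms bs * redeg_garrs[of x g bs] by simp
qed

lemma inner_face_hom:
  assumes "chain n w" "Suc r < length w"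
  shows "g (inner_face r w) \<in> hom A (x (fst (last w))) (x (snd (hd w))) (2 - int (length w))"
  using g_hom[OF chain_inner_face[OF assms]] assms
  by (simp add: inner_face_ends length_inner_face of_nat_diff)

lemma defect_hom:
  assumes "chain n w"
  shows "defect A x g w \<in> hom A (x (fst (last w))) (x (snd (hd w))) (2 - int (length w))"
  unfolding defect_def
  by (intro hom_add hom_sum hom_sgn_pow ends_ob assms bar_garrs inner_face_hom) auto

lemma composable_defect:
  assumes "chain n w" "(us, v, ws) \<in> block_cuts w"
    and "u \<in> hom A (x (fst (last v))) (x (snd (hd v))) (2 - int (length v))"
  shows "composable A (map (garr x g) us @
    Harr (x (fst (last v))) (x (snd (hd v))) (2 - int (length v)) u # map (garr x g) ws)"
proof (rule composable_replace1)
  have w: "w = concat (us @ v # ws)" "[] \<notin> set (us @ v # ws)"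
    using assms(2) by (auto simp: block_cuts_def)
  then show "composable A (map (garr x g) us @ garr x g v # map (garr x g) ws)"
    using composable_garrs[of "us @ v # ws"] assms(1) by simp
  have "chain n v" using assms(1) w chain_block[of n "us @ v # ws" v] by auto
  then show "is_arr A (Harr (x (fst (last v))) (x (snd (hd v))) (2 - int (length v)) u)"
    using assms(3) by (simp add: is_arr_def ends_ob)
qed auto

text \<open>Expanding the inner defects on the left produces two double sums.  The one with two operations of
\<open>A\<close> vanishes by \<open>bar_relation\<close>.  The one with an operation and a face is the sum of the operation
parts of the defects of the faces; their face parts cancel by \<open>inner_faces_cancel\<close>.\<close>

lemma defect_bianchi:
  assumes w: "chain n w"
  shows "(\<Sum>(us, v, ws)\<in>block_cuts w.
      sgn_pow (int (length (concat us))) (bar_opr A (map (garr x g) us @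
        Harr (x (fst (last v))) (x (snd (hd v))) (2 - int (length v)) (defect A x g v) #
        map (garr x g) ws))) =
    (\<Sum>r<length w - 1. sgn_pow (int r) (defect A x g (inner_face r w)))"
proof -
  let ?a = "\<lambda>v. Harr (x (fst (last v))) (x (snd (hd v))) (2 - int (length v))"
  let ?G = "map (garr x g)"
  let ?B = "\<lambda>us v ws u. bar_opr A (?G us @ ?a v u # ?G ws)"
  let ?s = "\<lambda>us. sgn_pow (int (length (concat us)))"
  \<comment> \<open>Additivity of the outer operation in the inserted defect.\<close>
  have step: "?s us (?B us v ws (defect A x g v)) =
      (\<Sum>vs\<in>splits v. ?s us (bar_opr A (?G us @ arr_of id 2 (bar_opr A) (?G vs) # ?G ws))) +
      (\<Sum>r<length v - 1. sgn_pow (int (length (concat us) + r))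
         (bar_opr A (?G (us @ inner_face r v # ws))))"
    if c: "(us, v, ws) \<in> block_cuts w" for us v ws
  proof -
    from c have w': "w = concat (us @ v # ws)" and ne: "[] \<notin> set (us @ v # ws)"
      by (auto simp: block_cuts_def)
    then have v: "chain n v" using w chain_block[of n "us @ v # ws" v] by auto
    note cu = composable_defect[OF w c]
    have c0: "composable A (?G us @ ?a v 0 # ?G ws)"
      by (rule cu) (simp add: hom_0 ends_ob v)
    have "?B us v ws (defect A x g v) =
        ?B us v ws (\<Sum>bs\<in>splits v. bar_opr A (?G bs)) +
        ?B us v ws (\<Sum>r<length v - 1. sgn_pow (int r) (g (inner_face r v)))"
      unfolding defect_def
      by (intro bar_opr_add cu hom_sum hom_sgn_pow ends_ob v bar_garrs inner_face_hom) auto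
    also have "?B us v ws (\<Sum>bs\<in>splits v. bar_opr A (?G bs)) =
        (\<Sum>vs\<in>splits v. bar_opr A (?G us @ arr_of id 2 (bar_opr A) (?G vs) # ?G ws))"
      using bar_garrs[OF v] by (subst bar_opr_sum[OF finite_splits c0]) auto
    also have "?B us v ws (\<Sum>r<length v - 1. sgn_pow (int r) (g (inner_face r v))) =
        (\<Sum>r<length v - 1. sgn_pow (int r) (?B us v ws (g (inner_face r v))))"
      by (subst bar_opr_sum[OF _ c0])
         (auto intro!: hom_sgn_pow ends_ob v inner_face_hom sum.cong bar_opr_sgn_pow cu)
    also have "\<dots> = (\<Sum>r<length v - 1. sgn_pow (int r)
         (bar_opr A (?G (us @ inner_face r v # ws))))"
      by (rule sum.cong) (auto simp: garr_def inner_face_ends length_inner_face of_nat_diff)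
    finally show ?thesis by (simp only: sgn_pow_plus sgn_pow_sum sgn_pow_add of_nat_add)
  qed
  have "(\<Sum>(us, v, ws)\<in>block_cuts w. ?s us (?B us v ws (defect A x g v))) =
      (\<Sum>(us, v, ws)\<in>block_cuts w.
        (\<Sum>vs\<in>splits v. ?s us (bar_opr A (?G us @ arr_of id 2 (bar_opr A) (?G vs) # ?G ws))) +
        (\<Sum>r<length v - 1. sgn_pow (int (length (concat us) + r))
           (bar_opr A (?G (us @ inner_face r v # ws)))))"
    using step by (intro sum.cong) auto
  also have "\<dots> =
      (\<Sum>(us, v, ws)\<in>block_cuts w.
        \<Sum>vs\<in>splits v. ?s us (bar_opr A (?G us @ arr_of id 2 (bar_opr A) (?G vs) # ?G ws))) +
      (\<Sum>(us, v, ws)\<in>block_cuts w.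
        \<Sum>r<length v - 1. sgn_pow (int (length (concat us) + r))
           (bar_opr A (?G (us @ inner_face r v # ws))))"
    by (simp add: sum.distrib case_prod_unfold)
  also have "(\<Sum>(us, v, ws)\<in>block_cuts w.
        \<Sum>vs\<in>splits v. ?s us (bar_opr A (?G us @ arr_of id 2 (bar_opr A) (?G vs) # ?G ws))) = 0"
    unfolding sum_block_cuts_splits
  proof (rule sum.neutral, rule ballI)
    fix bs assume bs: "bs \<in> splits w"
    have "0 = (\<Sum>(us, vs, ws)\<in>cuts (?G bs).
        sgn_pow (redeg us) (bar_opr A (us @ arr_of id 2 (bar_opr A) vs # ws)))"
      using bs w by (intro bar_relation[symmetric] composable_garrs) (auto simp: splits_def)
    also have "\<dots> = (\<Sum>(us, vs, ws)\<in>cuts bs.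
        ?s us (bar_opr A (?G us @ arr_of id 2 (bar_opr A) (?G vs) # ?G ws)))"
      unfolding sum_cuts
      by (rule sum.cong)
         (auto simp: take_map drop_map redeg_garrs intro!: sgn_pow_cong)
    finally show "(\<Sum>(us, vs, ws)\<in>cuts bs.
        ?s us (bar_opr A (?G us @ arr_of id 2 (bar_opr A) (?G vs) # ?G ws))) = 0" ..
  qed
  also have "(\<Sum>(us, v, ws)\<in>block_cuts w.
        \<Sum>r<length v - 1. sgn_pow (int (length (concat us) + r))
           (bar_opr A (?G (us @ inner_face r v # ws)))) =
      (\<Sum>r<length w - 1. \<Sum>bs\<in>splits (inner_face r w). sgn_pow (int r) (bar_opr A (?G bs)))"
    by (rule sum_block_cuts_inner_face[where h="\<lambda>r bs. sgn_pow (int r) (bar_opr A (?G bs))"])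
  also have "\<dots> = (\<Sum>r<length w - 1. sgn_pow (int r) (defect A x g (inner_face r w))) -
      (\<Sum>r<length w - 1. \<Sum>s<length w - 2.
         sgn_pow (int r) (sgn_pow (int s) (g (inner_face s (inner_face r w)))))"
    unfolding sum_subtractf[symmetric]
    by (rule sum.cong) (auto simp: defect_def sgn_pow_plus sgn_pow_sum length_inner_face numeral_2_eq_2)
  also have "\<dots> = (\<Sum>r<length w - 1. sgn_pow (int r) (defect A x g (inner_face r w)))"
    by (simp only: inner_faces_cancel diff_zero)
  finally show ?thesis by simp
qed

end

section \<open>Degenerate chains\<close>

context simplex_data
begin

text \<open>The form in which the identity is applied: a chain with vanishing defects of all blocks, the whole
chain included, cannot have exactly one inner face with nonzero defect.\<close>

lemma defect_inner_face_zero: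
  assumes w: "chain n w" and r0: "r0 < length w - 1"
    and blocks: "\<And>us v ws. (us, v, ws) \<in> block_cuts w \<Longrightarrow> defect A x g v = 0"
    and faces: "\<And>r. r < length w - 1 \<Longrightarrow> r \<noteq> r0 \<Longrightarrow> defect A x g (inner_face r w) = 0"
  shows "defect A x g (inner_face r0 w) = 0"
proof -
  have "(\<Sum>r<length w - 1. sgn_pow (int r) (defect A x g (inner_face r w))) =
    (\<Sum>r\<in>{r0}. sgn_pow (int r) (defect A x g (inner_face r w)))"
    by (rule sum.mono_neutral_right) (use r0 faces in auto)
  moreover have "(\<Sum>(us, v, ws)\<in>block_cuts w.
      sgn_pow (int (length (concat us))) (bar_opr A (map (garr x g) us @
        Harr (x (fst (last v))) (x (snd (hd v))) (2 - int (length v)) (defect A x g v) #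
        map (garr x g) ws))) = 0"
  proof (rule sum.neutral, clarify)
    fix us v ws assume c: "(us, v, ws) \<in> block_cuts w"
    then have "chain n v" using w chain_block[of n "us @ v # ws" v] by (auto simp: block_cuts_def)
    then have "composable A (map (garr x g) us @
        Harr (x (fst (last v))) (x (snd (hd v))) (2 - int (length v)) 0 # map (garr x g) ws)"
      by (intro composable_defect[OF w c]) (simp add: hom_0 ends_ob)
    from bar_opr_zero[OF this, of "Harr (x (fst (last v))) (x (snd (hd v))) (2 - int (length v)) 0"]
    show "sgn_pow (int (length (concat us))) (bar_opr A (map (garr x g) us @
        Harr (x (fst (last v))) (x (snd (hd v))) (2 - int (length v)) (defect A x g v) #
        map (garr x g) ws)) = 0"
      by (simp add: blocks[OF c])
  qed
  ultimately show ?thesis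
    using defect_bianchi[OF w] by (simp add: sgn_pow_def split: if_splits)
qed

text \<open>By strict unitality a cut of a chain through an identity edge contributes only if it isolates this edge and
has exactly one further block: longer blocks containing the edge have value \<open>0\<close>, higher operations
vanish on identities, and \<open>m\<^sub>1\<close> kills them.\<close>

lemma bar_opr_splits_degenerate:
  assumes unit: "\<And>j. j \<le> n \<Longrightarrow> g [(j, j)] = idt A (x j)"
    and degenerate: "\<And>w j. chain n w \<Longrightarrow> length w > 1 \<Longrightarrow> (j, j) \<in> set w \<Longrightarrow> g w = 0"
    and w: "chain n (u @ (j, j) # v)" and bs: "bs \<in> splits (u @ (j, j) # v)"
    and nz: "bar_opr A (map (garr x g) bs) \<noteq> 0"
  shows "u = [] \<and> v \<noteq> [] \<and> bs = [[(j, j)], v] \<or> u \<noteq> [] \<and> v = [] \<and> bs = [u, [(j, j)]]"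
proof -
  let ?e = "(j, j)"
  have c: "concat bs = u @ ?e # v" and ne: "[] \<notin> set bs" using bs by (auto simp: splits_def)
  have comp: "composable A (map (garr x g) bs)" using composable_garrs c ne w by simp
  have j: "j \<le> n" using w by (auto simp: chain_def)
  \<comment> \<open>The block that contains the given occurrence of the identity edge, which may also occur elsewhere.\<close>
  have "length u < length (concat bs)" by (simp add: c)
  from concat_position[OF this] obtain us b ws where b: "bs = us @ b # ws"
    "length (concat us) \<le> length u" "length u < length (concat us) + length b" by blast
  have lt: "length u - length (concat us) < length b" using b by linarith
  then have "concat bs ! length u = b ! (length u - length (concat us))"
    using b by (simp add: nth_append)
  then have e: "?e \<in> set b" using c nth_mem[OF lt] by simp
  have "b = [?e]"
  proof (rule ccontr)
    assume "b \<noteq> [?e]"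
    with e have "length b > 1" by (cases b rule: list.exhaust[OF _ list.exhaust[of "tl b"]]) auto
    moreover have "chain n b" using w b ne chain_block[of n bs b] by (auto simp flip: c)
    ultimately have "g b = 0" using degenerate e by blast
    then have "bar_opr A (map (garr x g) bs) = 0"
      using b by (intro bar_opr_zero[OF comp, of "garr x g b"]) auto
    with nz show False by simp
  qed
  then have "length (concat us) = length u" using b by simp
  with c b(1) \<open>b = [?e]\<close> have uv: "concat us = u" "concat ws = v" by auto
  have id: "garr x g [?e] = id_arr A (x j)"
    by (simp add: garr_def id_arr_def unit j)
  have "length bs \<le> 2"
  proof (rule ccontr)
    assume "\<not> length bs \<le> 2"
    then have "opr A (map (garr x g) bs) = 0"
      using b(1) \<open>b = [?e]\<close> id x_ob[OF j] by (intro opr_id_vanish[OF comp, of "x j"]) auto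
    with nz show False by (simp add: bar_opr_def)
  qed
  moreover have "length bs \<noteq> 1"
  proof
    assume "length bs = 1"
    then have "bs = [[?e]]" using b(1) \<open>b = [?e]\<close> by (auto simp: length_Suc_conv)
    then have "bar_opr A (map (garr x g) bs) = 0" using bar_opr_idt x_ob[OF j] id by simp
    with nz show False by simp
  qed
  ultimately have "length us + length ws = 1" using b(1) by (cases us; cases ws) auto
  then show ?thesis
    using b(1) uv ne \<open>b = [?e]\<close> by (auto simp: add_is_1 length_Suc_conv)
qed

text \<open>Only the faces next to the identity edge survive, and both are the chain with this edge deleted.  If
there are two of them, they cancel; if the edge is the first or last one, the only such face cancels
against \<open>m\<^sub>2\<close> with an identity.\<close>

lemma defect_degenerate:
  assumes unit: "\<And>j. j \<le> n \<Longrightarrow> g [(j, j)] = idt A (x j)"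
    and degenerate: "\<And>w j. chain n w \<Longrightarrow> length w > 1 \<Longrightarrow> (j, j) \<in> set w \<Longrightarrow> g w = 0"
    and w: "chain n (u @ (j, j) # v)"
  shows "defect A x g (u @ (j, j) # v) = 0"
proof -
  let ?e = "(j, j)" and ?w = "u @ (j, j) # v"
  let ?b = "\<lambda>bs. bar_opr A (map (garr x g) bs)"
  have splits: "u = [] \<and> v \<noteq> [] \<and> bs = [[?e], v] \<or> u \<noteq> [] \<and> v = [] \<and> bs = [u, [?e]]"
    if "bs \<in> splits ?w" "?b bs \<noteq> 0" for bs
  proof (rule bar_opr_splits_degenerate[OF _ _ w that])
    show "g [(k, k)] = idt A (x k)" if "k \<le> n" for k by (rule unit[OF that])
    show "g w' = 0" if "chain n w'" "length w' > 1" "(k, k) \<in> set w'" for w' k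
      by (rule degenerate[OF that])
  qed
  have j: "j \<le> n" using w by (auto simp: chain_def)
  have id: "garr x g [?e] = id_arr A (x j)"
    by (simp add: garr_def id_arr_def unit j)
  have face: "g (inner_face r ?w) =
      (if Suc r = length u \<or> r = length u then g (u @ v) else 0)" if r: "Suc r < length ?w" for r
  proof -
    consider "Suc r < length u" | "Suc r = length u" | "r = length u" | "length u < r" by linarith
    then show ?thesis
    proof cases
      case 1
      then have "inner_face r ?w = inner_face r u @ ?e # v"
        using inner_face_append[of r u "[]" "?e # v"] by simp
      then have "?e \<in> set (inner_face r ?w)" by simp
      moreover have "length (inner_face r ?w) > 1" using 1 by (simp add: length_inner_face)
      ultimately show ?thesis using degenerate[OF chain_inner_face[OF w r]] 1 by auto
    next
      case 2
      then obtain u' a b where u: "u = u' @ [(a, b)]" by (cases u rule: rev_cases) auto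
      then have "a = j" using w by (auto simp: chain_def successively_append_iff)
      then show ?thesis using 2 u inner_face_append[of 0 "[(a, b), ?e]" u' v] by simp
    next
      case 3
      then obtain a b v' where v: "v = (a, b) # v'" using r by (cases v) auto
      then have "b = j" using w by (auto simp: chain_def successively_append_iff)
      then show ?thesis using 3 v inner_face_append[of 0 "[?e, (a, b)]" u v'] by simp
    next
      case 4
      then have "inner_face r ?w = (u @ [?e]) @ inner_face (r - Suc (length u)) v @ []"
        using inner_face_append[of "r - Suc (length u)" v "u @ [?e]" "[]"] r by simp
      then have "?e \<in> set (inner_face r ?w)" by simp
      moreover have "length (inner_face r ?w) > 1" using 4 r by (simp add: length_inner_face)
      ultimately show ?thesis using degenerate[OF chain_inner_face[OF w r]] 4 by auto
    qed
  qed
  have "(\<Sum>r<length ?w - 1. sgn_pow (int r) (g (inner_face r ?w))) =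
      (\<Sum>r\<in>{r. Suc r < length ?w \<and> (Suc r = length u \<or> r = length u)}. sgn_pow (int r) (g (u @ v)))"
    by (rule sum.mono_neutral_cong_right) (auto simp: face)
  also have "\<dots> = - (\<Sum>bs\<in>splits ?w. ?b bs)"
  proof (cases "u = []")
    case u: True
    show ?thesis
    proof (cases "v = []")
      case True
      then have "(\<Sum>bs\<in>splits ?w. ?b bs) = 0" using splits u by (intro sum.neutral) blast
      then show ?thesis using u True by simp
    next
      case v: False
      have "chain n v" using w v u chain_append[of "[?e]" v n] by auto
      have xj: "tgt (garr x g v) = x j" using w v u chain_append[of "[?e]" v n] by auto
      have "(\<Sum>bs\<in>splits ?w. ?b bs) = (\<Sum>bs\<in>{[[?e], v]}. ?b bs)"
        by (rule sum.mono_neutral_right[OF finite_splits])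
           (use splits u v in \<open>auto simp: splits_def\<close>)
      also have "\<dots> = - g v"
        using opr_id_left[OF is_arr_garr[OF \<open>chain n v\<close>]] unfolding xj
        by (simp add: bar_opr_def id) (simp add: id_arr_def sgn_pow_def)
      moreover have "{r. Suc r < length ?w \<and> (Suc r = length u \<or> r = length u)} = {0}"
        using u v by auto
      ultimately show ?thesis using u by (simp add: sgn_pow_def)
    qed
  next
    case u: False
    show ?thesis
    proof (cases "v = []")
      case v: True
      have "chain n u" using w v u chain_append[of u "[?e]" n] by auto
      have xj: "src (garr x g u) = x j" using w v u chain_append[of u "[?e]" n] by auto
      have "(\<Sum>bs\<in>splits ?w. ?b bs) = (\<Sum>bs\<in>{[u, [?e]]}. ?b bs)"
        by (rule sum.mono_neutral_right[OF finite_splits])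
           (use splits u v in \<open>auto simp: splits_def\<close>)
      also have "\<dots> = sgn_pow (int (length u)) (g u)"
        using opr_id_right[OF is_arr_garr[OF \<open>chain n u\<close>]] unfolding xj
        by (simp add: bar_opr_def id) (simp add: id_arr_def sgn_pow_def)
      moreover have "{r. Suc r < length ?w \<and> (Suc r = length u \<or> r = length u)} = {length u - 1}"
        using u v by auto
      ultimately show ?thesis using u v by (cases u) (auto simp: sgn_pow_def)
    next
      case v: False
      have "(\<Sum>bs\<in>splits ?w. ?b bs) = 0" using splits u v by (intro sum.neutral) blast
      moreover have "{r. Suc r < length ?w \<and> (Suc r = length u \<or> r = length u)} =
          {length u - 1, length u}"
        using u v by (auto simp: neq_Nil_conv)
      ultimately show ?thesis using u by (cases u) (auto simp: sgn_pow_def)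
    qed
  qed
  finally show ?thesis by (simp add: defect_def)
qed

end

section \<open>Functors on the simplex as functions on chains\<close>

definition unit_arr :: "nat \<times> nat \<Rightarrow> (nat, 'k::field) harr" where
  "unit_arr e = Harr (fst e) (snd e) 0 1"

definition edge :: "('o, 'v) harr \<Rightarrow> 'o \<times> 'o" where
  "edge a = (src a, tgt a)"

lemma edge_unit_arr [simp]: "edge (unit_arr e) = e"
  by (simp add: edge_def unit_arr_def)

lemma map_edge_unit_arr [simp]: "map (edge \<circ> unit_arr) w = w"
  by (induction w) auto

lemma val_unit_arr [simp]: "val (unit_arr e) = 1"
  by (simp add: unit_arr_def)

lemma prod_val_units [simp]: "prod_list (map (val \<circ> unit_arr) w) = 1"
  by (induction w) auto

lemma graded_space_simplex: "graded_space (ainf_simplex n :: ('k::field, nat, 'k) ainf)"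
proof (rule graded_space.intro)
  show vs: "vector_space (scl (ainf_simplex n :: ('k, nat, 'k) ainf))"
    by (simp add: vector_space_def ainf_simplex_def algebra_simps)
  then interpret vector_space "scl (ainf_simplex n :: ('k, nat, 'k) ainf)" .
  show "subspace (hom (ainf_simplex n :: ('k, nat, 'k) ainf) i j d)" for i j d
    unfolding subspace_def by (simp add: ainf_simplex_def)
qed

interpretation simplex: graded_space "ainf_simplex n :: ('k::field, nat, 'k) ainf" for n
  by (rule graded_space_simplex)

lemma is_arr_simplex:
  "is_arr (ainf_simplex n) a \<longleftrightarrow>
    src a \<le> n \<and> tgt a \<le> n \<and> (val a \<noteq> 0 \<longrightarrow> src a \<le> tgt a \<and> deg a = 0)"
  by (auto simp: is_arr_def ainf_simplex_def)

lemma composable_units: "composable (ainf_simplex n) (map unit_arr w) \<longleftrightarrow> chain n w"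
  by (force simp: composable_def chain_def is_arr_simplex unit_arr_def successively_map)

lemma composable_nonzero:
  assumes "composable (ainf_simplex n) as" "prod_list (map val as) \<noteq> 0"
  shows "chain n (map edge as)" "\<And>a. a \<in> set as \<Longrightarrow> deg a = 0"
proof -
  have "val a \<noteq> 0" if "a \<in> set as" for a
    using assms(2) that by (auto simp: prod_list_zero_iff)
  then show "chain n (map edge as)" "\<And>a. a \<in> set as \<Longrightarrow> deg a = 0"
    using assms(1) by (auto simp: composable_def chain_def is_arr_simplex edge_def successively_map)
qed

lemma prod_val_eq_0_iff:
  "prod_list (map val as) = 0 \<longleftrightarrow> (\<exists>a\<in>set as. val a = (0::'k::field))"
  by (auto simp: prod_list_zero_iff)

lemma opr_simplex [simp]:
  "opr (ainf_simplex n) as = (if length as = 2 then val (as ! 0) * val (as ! 1) else 0)"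
  by (simp add: ainf_simplex_def)

lemma ob_simplex [simp]: "ob (ainf_simplex n) = {..n}"
  by (simp add: ainf_simplex_def)

lemma degsum_zero: "(\<And>a. a \<in> set as \<Longrightarrow> deg a = 0) \<Longrightarrow> degsum as = 0"
  by (induction as) (auto simp: degsum_def)

lemma simplex_opr_arr:
  assumes "composable (ainf_simplex n :: ('k::field, nat, 'k) ainf) as"
  shows "is_arr (ainf_simplex n :: ('k, nat, 'k) ainf)
    (arr_of id 2 (opr (ainf_simplex n :: ('k, nat, 'k) ainf)) as)"
proof (cases "length as = 2")
  case True
  then obtain a b where "as = [a, b]" by (auto simp: numeral_2_eq_2 length_Suc_conv)
  then show ?thesis using assms
    by (auto simp: composable_def is_arr_simplex arr_of_def degsum_def)
next
  case False
  moreover have "hd as \<in> set as" "last as \<in> set as" using assms by (auto simp: composable_def)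
  ultimately show ?thesis using assms
    by (auto simp: composable_def is_arr_simplex arr_of_def)
qed

lemma composable_insertion:
  assumes "composable (ainf_simplex n :: ('k::field, nat, 'k) ainf) as" "1 \<le> s" "r + s \<le> length as"
  shows "composable (ainf_simplex n :: ('k, nat, 'k) ainf)
    (take r as @ arr_of id 2 (opr (ainf_simplex n :: ('k, nat, 'k) ainf)) (take s (drop r as)) #
     drop (r + s) as)"
proof (rule composable_replace[of _ _ "take s (drop r as)"])
  have as: "take r as @ take s (drop r as) @ drop (r + s) as = as"
    by (metis add.commute append_take_drop_id drop_drop)
  then show c: "composable (ainf_simplex n :: ('k, nat, 'k) ainf)
      (take r as @ take s (drop r as) @ drop (r + s) as)"
    using assms(1) by simp
  show ne: "take s (drop r as) \<noteq> []" using assms by auto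
  show "is_arr (ainf_simplex n :: ('k, nat, 'k) ainf)
      (arr_of id 2 (opr (ainf_simplex n :: ('k, nat, 'k) ainf)) (take s (drop r as)))"
    by (rule simplex_opr_arr) (use composable_infix[OF c ne] in simp)
qed (auto simp: arr_of_def)

lemma inner_face_conv:
  "Suc r < length w \<Longrightarrow>
   inner_face r w = take r w @ (fst (w ! Suc r), snd (w ! r)) # drop (r + 2) w"
  by (induction r w rule: inner_face.induct) auto

lemma choose_two_add: "(a + b) choose 2 = (a choose 2) + (b choose 2) + a * b"
  by (induction a) (auto simp: numeral_2_eq_2)

lemma eps_snoc: "eps (is @ [j]) = eps is + (1 - int j) * int (sum_list is)"
proof -
  have "(\<Sum>l<length is. int (is ! l)) = int (sum_list is)"
    by (simp add: sum_list_sum_nth lessThan_atLeast0)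
  then show ?thesis by (simp add: eps_def nth_append)
qed

text \<open>The sign of a term of the functor equation becomes independent of the cut once the operation is
shifted and each block of length \<open>i\<close> carries \<open>(-1)\<^bsup>i(i-1)/2\<^esup>\<close>.  The reason is that
\<open>\<Sum>\<^bsub>k<l\<^esub> i\<^sub>k i\<^sub>l\<close> is the difference between the binomial coefficient of the total length and those of
the parts.\<close>

lemma eps_shift_exp:
  "even (eps (map length bs) - shift_exp (map (garr x g) bs) -
     int (length (concat bs) choose 2) + (\<Sum>b\<leftarrow>bs. int (length b choose 2)))"
proof (induction bs rule: rev_induct)
  case Nil
  then show ?case by (simp add: eps_def numeral_2_eq_2)
next
  case (snoc b bs)
  let ?S = "length (concat bs)"
  have eq: "eps (map length (bs @ [b])) - shift_exp (map (garr x g) (bs @ [b])) -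
       int (length (concat (bs @ [b])) choose 2) + (\<Sum>b\<leftarrow>bs @ [b]. int (length b choose 2)) =
     eps (map length bs) - shift_exp (map (garr x g) bs) -
       int (?S choose 2) + (\<Sum>b\<leftarrow>bs. int (length b choose 2)) +
       2 * (int ?S * (1 - int (length b)))"
    using eps_snoc[of "map length bs" "length b"]
    by (simp add: shift_exp_append redeg_garrs choose_two_add length_concat algebra_simps)
  show ?case unfolding eq using snoc by simp
qed

lemma koszul_zero: "(\<And>b a. b \<in> set bs \<Longrightarrow> a \<in> set b \<Longrightarrow> deg a = 0) \<Longrightarrow> koszul bs = 0"
proof -
  assume a: "\<And>b a. b \<in> set bs \<Longrightarrow> a \<in> set b \<Longrightarrow> deg a = 0"
  have "degsum (bs ! l) = 0" if "l < length bs" for l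
    using a that by (intro degsum_zero) (auto dest: nth_mem)
  then show ?thesis by (simp add: koszul_def)
qed

lemma composable_blocks:
  assumes "\<And>as. composable A as \<Longrightarrow> is_arr B (arr_of p d F as)"
    and "composable A (concat bs)" "[] \<notin> set bs"
  shows "composable B (map (arr_of p d F) bs)"
  using assms(2,3)
proof (induction bs)
  case Nil
  then show ?case by (simp add: composable_def)
next
  case (Cons b bs)
  show ?case
  proof (cases bs)
    case Nil
    then show ?thesis using Cons by (simp add: assms(1))
  next
    case (Cons b' bs')
    then have "composable A b" "composable A (concat bs)" "src (last b) = tgt (hd b')" "bs \<noteq> []"
      using Cons.prems composable_append[of b "concat bs" A] by auto
    moreover have "composable B (map (arr_of p d F) bs)" using Cons.IH Cons.prems calculation by auto
    ultimately show ?thesis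
      using Cons composable_append[of "[arr_of p d F b]" "map (arr_of p d F) bs" B]
      by (simp add: assms(1)) (simp add: arr_of_def)
  qed
qed

lemma prod_signs:
  fixes c :: "'a \<Rightarrow> 'k::field" and e :: "'a \<Rightarrow> int"
  shows "prod_list (map (\<lambda>b. (if even (e b) then 1 else - 1) * c b) bs) =
    (if even (\<Sum>b\<leftarrow>bs. e b) then 1 else - 1) * prod_list (map c bs)"
  by (induction bs) auto

lemma prod_list_concat: "prod_list (map h (concat bs)) = (\<Prod>b\<leftarrow>bs. prod_list (map h b) :: 'k::field)"
  by (induction bs) auto

text \<open>A multilinear map on the simplex that is determined by its values \<open>g\<close> on chains, up to the sign that
belongs to the degree shift.  Lists with an entry \<open>0\<close> need not be chains; the coefficient \<open>0\<close> takes
care of them.\<close>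

locale simplex_map_data = simplex_data A n x g
  for A :: "('k::field, 'o, 'v::ab_group_add) ainf" and n x g +
  fixes F :: "(nat, 'k) harr list \<Rightarrow> 'v"
  assumes F_eq: "composable (ainf_simplex n :: ('k, nat, 'k) ainf) as \<Longrightarrow>
    F as = sgn_pow (int (length as choose 2)) (scl A (prod_list (map val as)) (g (map edge as)))"
begin

abbreviation S :: "('k, nat, 'k) ainf" where "S \<equiv> ainf_simplex n"

lemma F_arr:
  assumes "composable S as"
  shows "is_arr A (arr_of x 1 F as)"
proof -
  have "hd as \<in> set as" "last as \<in> set as" "\<forall>a\<in>set as. is_arr S a"
    using assms by (auto simp: composable_def)
  then have ob: "x (src (last as)) \<in> ob A" "x (tgt (hd as)) \<in> ob A"
    by (auto simp: is_arr_simplex x_ob)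
  have ne: "as \<noteq> []" using assms by (auto simp: composable_def)
  show ?thesis
  proof (cases "prod_list (map val as) = 0")
    case True
    then show ?thesis using ob by (simp add: is_arr_def arr_of_def F_eq[OF assms] hom_0)
  next
    case False
    have "degsum as = 0" using composable_nonzero(2)[OF assms False] by (rule degsum_zero)
    then show ?thesis
      using ob ne g_hom[OF composable_nonzero(1)[OF assms False]]
      by (simp add: is_arr_def arr_of_def F_eq[OF assms] hom_sgn_pow hom_scl hd_map last_map edge_def)
  qed
qed

lemma F_multilinear: "graded_multilinear S A x 1 F"
  unfolding graded_multilinear_def
proof (intro conjI allI impI)
  fix as bs i j e u v
  assume u: "composable S (as @ Harr i j e u # bs)" and v: "composable S (as @ Harr i j e v # bs)"
  have "composable S (as @ Harr i j e (u + v) # bs)"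
    by (rule composable_replace1[OF u])
       (use u v in \<open>auto simp: composable_def is_arr_def simplex.hom_add\<close>)
  with u v show "F (as @ Harr i j e (u + v) # bs) =
      F (as @ Harr i j e u # bs) + F (as @ Harr i j e v # bs)"
    by (simp add: F_eq edge_def distrib_left distrib_right vs.scale_left_distrib sgn_pow_plus)
next
  fix as bs i j e u c
  assume u: "composable S (as @ Harr i j e u # bs)"
  have "composable S (as @ Harr i j e (scl S c u) # bs)"
    by (rule composable_replace1[OF u])
       (use u in \<open>auto simp: composable_def is_arr_def simplex.hom_scl\<close>)
  with u show "F (as @ Harr i j e (scl S c u) # bs) = scl A c (F (as @ Harr i j e u # bs))"
    by (simp add: F_eq edge_def scl_sgn_pow) (simp add: ainf_simplex_def mult.left_commute mult.assoc)
qed (rule F_arr)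

text \<open>In the simplex only \<open>m\<^sub>2\<close> is nonzero, and inserting it composes two consecutive edges.\<close>

lemma insertion_sum_F:
  assumes as: "composable S as"
  shows "insertion_sum S F as = - sgn_pow (int (length as choose 2)) (scl A (prod_list (map val as))
    (\<Sum>r<length as - 1. sgn_pow (int r) (g (inner_face r (map edge as)))))"
proof -
  let ?ins = "\<lambda>r s. take r as @ arr_of id 2 (opr S) (take s (drop r as)) # drop (r + s) as"
  let ?t = "\<lambda>(r, s, t). sgn_pow (int s * int r + int t + (2 - int s) * degsum (take r as)) (F (?ins r s))"
  let ?I = "{(r, s, t). r + s + t = length as \<and> 1 \<le> s}"
  have "insertion_sum S F as = sum ?t ?I"
    by (simp add: insertion_sum_def)
  also have "\<dots> = sum ?t {(r, s, t). r + s + t = length as \<and> s = 2}"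
  proof (rule sum.mono_neutral_right[OF finite_insertions])
    show "\<forall>z\<in>?I - {(r, s, t). r + s + t = length as \<and> s = 2}. ?t z = 0"
    proof
      fix z assume "z \<in> ?I - {(r, s, t). r + s + t = length as \<and> s = 2}"
      then obtain r s t where z: "z = (r, s, t)" and rs: "r + s + t = length as" "1 \<le> s" "s \<noteq> 2"
        by auto
      then have "composable S (?ins r s)" by (intro composable_insertion as) auto
      moreover have "prod_list (map val (?ins r s)) = 0"
        using rs by (auto simp: arr_of_def)
      ultimately have "F (?ins r s) = 0" by (simp only: F_eq) simp
      then show "?t z = 0" by (simp only: z prod.case sgn_pow_0)
    qed
  qed auto
  also have "\<dots> = (\<Sum>r<length as - 1. ?t (r, 2, length as - 2 - r))"
    by (rule sum.reindex_bij_witness[where i="\<lambda>r. (r, 2, length as - 2 - r)" and j="\<lambda>(r, s, t). r"])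
       (auto intro!: arg_cong2[of _ _ _ _ sgn_pow])
  also have "\<dots> = (\<Sum>r<length as - 1. - sgn_pow (int (length as choose 2))
      (scl A (prod_list (map val as)) (sgn_pow (int r) (g (inner_face r (map edge as))))))"
  proof (rule sum.cong[OF refl])
    fix r assume "r \<in> {..<length as - 1}"
    then have r: "Suc r < length as" by auto
    have d: "drop r as = as ! r # as ! Suc r # drop (r + 2) as"
      using r by (simp add: Cons_nth_drop_Suc)
    then have two: "take 2 (drop r as) = [as ! r, as ! Suc r]"
      by simp
    have split: "as = take r as @ as ! r # as ! Suc r # drop (r + 2) as"
      by (simp only: d[symmetric] append_take_drop_id)
    have len: "length (?ins r 2) = length as - 1" using r by simp
    have "prod_list (map val as) =
        prod_list (map val (take r as @ as ! r # as ! Suc r # drop (r + 2) as))"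
      using split by (rule arg_cong)
    then have "prod_list (map val (?ins r 2)) = prod_list (map val as)"
      by (simp add: two arr_of_def mult.assoc)
    moreover have "map edge (?ins r 2) = inner_face r (map edge as)"
      using r by (simp add: inner_face_conv two arr_of_def edge_def take_map drop_map)
    moreover have "composable S (?ins r 2)" using r by (intro composable_insertion as) auto
    ultimately have F: "F (?ins r 2) = sgn_pow (int (length as - 1 choose 2))
        (scl A (prod_list (map val as)) (g (inner_face r (map edge as))))"
      by (simp only: F_eq len)
    have "int (length as choose 2) = int (length as - 1 choose 2) + int (length as) - 1"
      using r by (cases "length as") (auto simp: numeral_2_eq_2)
    then have "even (int 2 * int r + int (length as - 2 - r) + (2 - int 2) * degsum (take r as) +
        int (length as - 1 choose 2) - (1 + int (length as choose 2) + int r))"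
      using r by (simp add: of_nat_diff)
    from sgn_pow_cong[OF this]
    have "sgn_pow (int 2 * int r + int (length as - 2 - r) + (2 - int 2) * degsum (take r as) +
        int (length as - 1 choose 2)) v = - sgn_pow (int (length as choose 2) + int r) v" for v :: 'v
      by (rule trans) (auto simp: sgn_pow_def)
    then show "?t (r, 2, length as - 2 - r) = - sgn_pow (int (length as choose 2))
      (scl A (prod_list (map val as)) (sgn_pow (int r) (g (inner_face r (map edge as)))))"
      by (simp only: prod.case F scl_sgn_pow sgn_pow_add[symmetric])
  qed
  finally show ?thesis
    by (simp add: sum_negf vs.scale_sum_right sgn_pow_sum)
qed

text \<open>Every block is mapped to a scalar multiple of \<open>garr\<close> of its underlying chain.  The scalars multiply to the
coefficient of the whole list, and the signs combine to a common one by \<open>eps_shift_exp\<close>.\<close>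

lemma tensor_sum_F:
  assumes as: "composable S as"
  shows "tensor_sum (opr A) x F as = sgn_pow (int (length as choose 2)) (scl A (prod_list (map val as))
    (\<Sum>bs\<in>splits (map edge as). bar_opr A (map (garr x g) bs)))"
proof -
  have eq: "sgn_pow (eps is + koszul (blocks is as)) (opr A (map (arr_of x 1 F) (blocks is as))) =
      sgn_pow (int (length as choose 2)) (scl A (prod_list (map val as))
        (bar_opr A (map (garr x g) (blocks is (map edge as)))))"
    if "is": "is \<in> compositions (length as)" for "is"
  proof -
    define bs where "bs = blocks is as"
    have bs: "concat bs = as" "[] \<notin> set bs"
      using blocks_in_splits[OF "is"] by (auto simp: bs_def splits_def)
    have len: "map length bs = is"
      using "is" map_length_blocks by (auto simp: bs_def compositions_def)
    have comp: "composable S b" if b: "b \<in> set bs" for b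
    proof -
      obtain us ws where "bs = us @ b # ws" using split_list[OF b] by blast
      then have "as = concat us @ b @ concat ws" "b \<noteq> []" using bs by auto
      then show ?thesis using as composable_infix[of S "concat us" b "concat ws"] by simp
    qed
    have c: "composable A (map (arr_of x 1 F) bs)"
      by (rule composable_blocks[OF F_arr]) (use as bs in auto)
    show ?thesis
    proof (cases "prod_list (map val as) = 0")
      case True
      then obtain a b where "a \<in> set b" "b \<in> set bs" "val a = 0"
        using bs(1) by (auto simp: prod_val_eq_0_iff)
      then have "prod_list (map val b) = 0" by (auto simp: prod_val_eq_0_iff)
      then have "F b = 0" using F_eq[OF comp] \<open>b \<in> set bs\<close> by simp
      then have "opr A (map (arr_of x 1 F) bs) = 0"
        using \<open>b \<in> set bs\<close>
        by (intro multilinear_zero[OF graded_space_axioms opr_multilinear vector_space_scl c,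
              of "arr_of x 1 F b"]) (auto simp: arr_of_def)
      with True show ?thesis by (simp add: bs_def)
    next
      case False
      have nz: "prod_list (map val b) \<noteq> 0" if "b \<in> set bs" for b
        using False that bs(1) by (auto simp: prod_val_eq_0_iff)
      let ?zs = "map (\<lambda>b. ((if even (int (length b choose 2)) then 1 else - 1) * prod_list (map val b),
        garr x g (map edge b))) bs"
      have "arr_of x 1 F b = scale A ((if even (int (length b choose 2)) then 1 else - 1) *
          prod_list (map val b)) (garr x g (map edge b))" if b: "b \<in> set bs" for b
      proof -
        have "degsum b = 0"
          using composable_nonzero(2)[OF comp nz] b by (intro degsum_zero) auto
        moreover have "b \<noteq> []" using bs b by auto
        ultimately show ?thesis using F_eq[OF comp[OF b]]
          by (simp add: arr_of_def scale_def hd_map last_map edge_def sgn_pow_def)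
      qed
      then have m: "map (arr_of x 1 F) bs = [] @ map (\<lambda>(c, a). scale A c a) ?zs" by simp
      have c': "composable A ([] @ map snd ?zs)"
      proof -
        have "chain n (concat (map (map edge) bs))"
          using composable_nonzero(1)[OF as False] bs by (simp add: map_concat[symmetric])
        then have "composable A (map (garr x g) (map (map edge) bs))"
          by (rule composable_garrs) (use bs in auto)
        then show ?thesis by (simp add: comp_def)
      qed
      have "opr A (map (arr_of x 1 F) bs) =
          scl A (prod_list (map fst ?zs)) (opr A ([] @ map snd ?zs))"
        unfolding m
        by (rule multilinear_scale_list[OF graded_space_axioms opr_multilinear vector_space_scl c'])
      also have "prod_list (map fst ?zs) =
          (if even (\<Sum>b\<leftarrow>bs. int (length b choose 2)) then 1 else - 1) * prod_list (map val as)"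
        using prod_signs[of "\<lambda>b. int (length b choose 2)" "\<lambda>b. prod_list (map val b)" bs]
          prod_list_concat[of val bs] bs(1) by (simp add: comp_def)
      also have "[] @ map snd ?zs = map (garr x g) (map (map edge) bs)"
        by simp
      also have "opr A \<dots> = sgn_pow (shift_exp (map (garr x g) (map (map edge) bs)))
          (bar_opr A (map (garr x g) (map (map edge) bs)))"
        by (simp add: bar_opr_def sgn_pow_def)
      finally have o: "opr A (map (arr_of x 1 F) bs) =
          sgn_pow ((\<Sum>b\<leftarrow>bs. int (length b choose 2)) +
            shift_exp (map (garr x g) (map (map edge) bs)))
          (scl A (prod_list (map val as)) (bar_opr A (map (garr x g) (map (map edge) bs))))"
        by (simp add: sgn_pow_def)
      \<comment> \<open>The simplex is concentrated in degree \<open>0\<close>, so only \<open>eps\<close> contributes to the sign.\<close>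
      have "koszul bs = 0"
        by (rule koszul_zero) (use composable_nonzero(2)[OF comp nz] in blast)
      moreover have "even (eps is - shift_exp (map (garr x g) (map (map edge) bs)) -
          int (length as choose 2) + (\<Sum>b\<leftarrow>bs. int (length b choose 2)))"
        using eps_shift_exp[of "map (map edge) bs" x g] len bs(1)
        by (simp add: comp_def map_concat[symmetric])
      ultimately have "even (eps is + koszul bs + ((\<Sum>b\<leftarrow>bs. int (length b choose 2)) +
            shift_exp (map (garr x g) (map (map edge) bs))) - int (length as choose 2))"
        by presburger
      from sgn_pow_cong[OF this] show ?thesis
        by (simp add: o blocks_map flip: bs_def sgn_pow_add)
    qed
  qed
  then show ?thesis
    by (simp add: tensor_sum_def sum_splits vs.scale_sum_right sgn_pow_sum eq)
qed

lemma functor_equation_defect: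
  assumes "composable S as"
  shows "insertion_sum S F as - tensor_sum (opr A) x F as =
    - sgn_pow (int (length as choose 2)) (scl A (prod_list (map val as)) (defect A x g (map edge as)))"
  by (simp add: insertion_sum_F tensor_sum_F assms defect_def vs.scale_right_distrib sgn_pow_plus)

lemma ainf_functorI:
  assumes ext: "x \<in> extensional {..n}" "\<And>as. \<not> composable S as \<Longrightarrow> F as = 0"
    and defect: "\<And>w. chain n w \<Longrightarrow> defect A x g w = 0"
    and unit: "\<And>j. j \<le> n \<Longrightarrow> g [(j, j)] = idt A (x j)"
    and degenerate: "\<And>w j. chain n w \<Longrightarrow> length w > 1 \<Longrightarrow> (j, j) \<in> set w \<Longrightarrow> g w = 0"
  shows "ainf_functor S A \<lparr>on_ob = x, on_arr = F\<rparr>"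
proof
  show "on_ob \<lparr>on_ob = x, on_arr = F\<rparr> \<in> ob S \<rightarrow>\<^sub>E ob A"
    using ext(1) x_ob by (auto simp: ainf_simplex_def PiE_def)
  show "graded_multilinear S A (on_ob \<lparr>on_ob = x, on_arr = F\<rparr>) 1 (on_arr \<lparr>on_ob = x, on_arr = F\<rparr>)"
    using F_multilinear by simp
  fix as
  show "on_arr \<lparr>on_ob = x, on_arr = F\<rparr> as = 0" if "\<not> composable S as" using that ext by simp
  show "insertion_sum S (on_arr \<lparr>on_ob = x, on_arr = F\<rparr>) as =
      tensor_sum (opr A) (on_ob \<lparr>on_ob = x, on_arr = F\<rparr>) (on_arr \<lparr>on_ob = x, on_arr = F\<rparr>) as"
    if as: "composable S as"
  proof -
    have "scl A (prod_list (map val as)) (defect A x g (map edge as)) = 0"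
      using composable_nonzero(1)[OF as] defect by (cases "prod_list (map val as) = 0") auto
    then show ?thesis using functor_equation_defect[OF as] by auto
  qed
  fix j assume "j \<in> ob S"
  then have j: "j \<le> n" by (simp add: ainf_simplex_def)
  have id: "id_arr S j = Harr j j 0 1" by (simp add: id_arr_def ainf_simplex_def)
  show "on_arr \<lparr>on_ob = x, on_arr = F\<rparr> [id_arr S j] = idt A (on_ob \<lparr>on_ob = x, on_arr = F\<rparr> j)"
    using F_eq[of "[id_arr S j]"] unit[OF j] j
    by (simp add: id is_arr_simplex edge_def)
       (simp add: sgn_pow_def numeral_2_eq_2)
  show "on_arr \<lparr>on_ob = x, on_arr = F\<rparr> as = 0"
    if as: "composable S as" and "1 < length as" "id_arr S j \<in> set as"
  proof (cases "prod_list (map val as) = 0")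
    case False
    have "(j, j) \<in> set (map edge as)" using that(3) by (force simp: id edge_def)
    then have "g (map edge as) = 0"
      using degenerate[OF composable_nonzero(1)[OF as False]] that(2) by simp
    then show ?thesis using F_eq[OF as] by simp
  qed (simp add: F_eq[OF as])
qed

end

text \<open>The sign is the one that \<open>eps_shift_exp\<close> attaches to a block.\<close>

definition chain_val :: "(nat, 'k::field, 'o, 'v::ab_group_add) ainf_fun \<Rightarrow> (nat \<times> nat) list \<Rightarrow> 'v" where
  "chain_val f w = sgn_pow (int (length w choose 2)) (on_arr f (map unit_arr w))"

text \<open>The space of morphisms along a chain is spanned by a single tensor of generators.\<close>

lemma functor_on_arr:
  fixes A :: "('k::field, 'o, 'v::ab_group_add) ainf"
  assumes "ainf_category A" "ainf_functor (ainf_simplex n) A f" "composable (ainf_simplex n) as"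
  shows "on_arr f as = scl A (prod_list (map val as)) (on_arr f (map unit_arr (map edge as)))"
proof -
  interpret ainf_category A by fact
  interpret f: ainf_functor "ainf_simplex n" A f by fact
  show ?thesis
  proof (cases "prod_list (map val as) = 0")
    case True
    then obtain a where "a \<in> set as" "val a = 0" by (auto simp: prod_val_eq_0_iff)
    then have "on_arr f as = 0"
      using multilinear_zero[OF simplex.graded_space_axioms f.on_arr_multilinear vector_space_scl assms(3)]
      by blast
    with True show ?thesis by simp
  next
    case False
    let ?zs = "map (\<lambda>a. (val a, unit_arr (edge a))) as"
    have c: "composable (ainf_simplex n) ([] @ map snd ?zs)"
      using composable_units[of n "map edge as"] composable_nonzero(1)[OF assms(3) False]
      by (simp add: comp_def)
    have "map (\<lambda>(c, a). scale (ainf_simplex n) c a) ?zs = map (\<lambda>a. a) as"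
      using composable_nonzero(2)[OF assms(3) False] unfolding map_map
      by (intro map_cong) (auto simp: scale_def unit_arr_def edge_def ainf_simplex_def intro: harr.expand)
    then show ?thesis
      using multilinear_scale_list[OF simplex.graded_space_axioms f.on_arr_multilinear vector_space_scl c]
      by (simp add: comp_def)
  qed
qed

lemma functor_map_data:
  fixes A :: "('k::field, 'o, 'v::ab_group_add) ainf"
  assumes "ainf_category A" "ainf_functor (ainf_simplex n) A f"
  shows "simplex_map_data A n (on_ob f) (chain_val f) (on_arr f)"
proof -
  interpret ainf_category A by fact
  interpret f: ainf_functor "ainf_simplex n" A f by fact
  show ?thesis
  proof
    show ob: "on_ob f j \<in> ob A" if "j \<le> n" for j
      using f.on_ob_funcset that by (auto simp: ainf_simplex_def)
    show "chain_val f w \<in> hom A (on_ob f (fst (last w))) (on_ob f (snd (hd w))) (1 - int (length w))"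
      if w: "chain n w" for w
    proof -
      have ne: "w \<noteq> []" using w by (auto simp: chain_def)
      have "degsum (map unit_arr w :: (nat, 'k) harr list) = 0"
        by (rule degsum_zero) (auto simp: unit_arr_def)
      moreover have "is_arr A (arr_of (on_ob f) 1 (on_arr f) (map unit_arr w))"
        using f.on_arr_multilinear w composable_units by (auto simp: graded_multilinear_def)
      ultimately show ?thesis using ne chain_ends[OF w] ob
        by (simp add: is_arr_def arr_of_def chain_val_def hd_map last_map unit_arr_def hom_sgn_pow)
    qed
    show "on_arr f as = sgn_pow (int (length as choose 2))
        (scl A (prod_list (map val as)) (chain_val f (map edge as)))"
      if "composable (ainf_simplex n) as" for as
      using functor_on_arr[OF assms that] by (simp add: chain_val_def scl_sgn_pow)
  qed
qed

lemma functor_defect: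
  fixes A :: "('k::field, 'o, 'v::ab_group_add) ainf"
  assumes "ainf_category A" "ainf_functor (ainf_simplex n) A f" "chain n w"
  shows "defect A (on_ob f) (chain_val f) w = 0"
proof -
  interpret f: ainf_functor "ainf_simplex n" A f by fact
  interpret simplex_map_data A n "on_ob f" "chain_val f" "on_arr f"
    by (rule functor_map_data) fact+
  have c: "composable S (map unit_arr w)" using assms(3) by (simp add: composable_units)
  show ?thesis
    using functor_equation_defect[OF c] f.functor_relation[OF c]
    by (simp add: sgn_pow_def split: if_splits)
qed

lemma id_arr_simplex: "id_arr (ainf_simplex n) j = unit_arr (j, j)"
  by (simp add: id_arr_def ainf_simplex_def unit_arr_def)

lemma chain_val_identity:
  assumes "ainf_functor (ainf_simplex n) A f" "j \<le> n"
  shows "chain_val f [(j, j)] = idt A (on_ob f j)"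
  using ainf_functor.on_arr_id[OF assms(1), of j] assms(2)
  by (simp add: chain_val_def id_arr_simplex) (simp add: ainf_simplex_def sgn_pow_def numeral_2_eq_2)

lemma chain_val_degenerate:
  assumes "ainf_functor (ainf_simplex n) A f" "chain n w" "length w > 1" "(j, j) \<in> set w"
  shows "chain_val f w = 0"
proof -
  have "j \<le> n" using assms(2,4) by (auto simp: chain_def)
  then have "on_arr f (map unit_arr w) = 0"
    using ainf_functor.on_arr_id_vanish[OF assms(1), of "map unit_arr w" j] assms
    by (force simp: composable_units id_arr_simplex)
  then show ?thesis by (simp add: chain_val_def)
qed

lemma inner_face_map: "inner_face r (map (map_prod h h) w) = map (map_prod h h) (inner_face r w)"
  by (induction r w rule: inner_face.induct) auto

text \<open>Vertex maps commute with cutting and with composing edges, so pulling back values along a vertex map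
pulls back the defect.\<close>

lemma defect_map:
  "defect A x g (map (map_prod h h) w) = defect A (x \<circ> h) (\<lambda>w. g (map (map_prod h h) w)) w"
proof -
  have "map (garr x g) (blocks is (map (map_prod h h) w)) =
      map (garr (x \<circ> h) (\<lambda>w. g (map (map_prod h h) w))) (blocks is w)"
    if "is": "is \<in> compositions (length w)" for "is"
  proof -
    have "b \<noteq> []" if "b \<in> set (blocks is w)" for b
      using blocks_in_splits[OF "is"] that by (auto simp: splits_def)
    then show ?thesis
      by (auto simp: blocks_map garr_def hd_map last_map)
  qed
  then show ?thesis by (simp add: defect_def sum_splits inner_face_map)
qed

section \<open>The nerve is a simplicial set\<close>

lemma chain_map:
  "\<theta> \<in> delta_maps m n \<Longrightarrow> chain m w \<Longrightarrow> chain n (map (map_prod \<theta> \<theta>) w)"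
  unfolding chain_def delta_maps_def
  by (fastforce simp: successively_map mono_on_def elim: successively_mono)

text \<open>The linear part of the functor between simplices that \<open>\<theta>\<close> induces.\<close>

definition push :: "(nat \<Rightarrow> nat) \<Rightarrow> (nat, 'k) harr \<Rightarrow> (nat, 'k) harr" where
  "push \<theta> a = Harr (\<theta> (src a)) (\<theta> (tgt a)) (deg a) (val a)"

lemma push_simps [simp]:
  "src (push \<theta> a) = \<theta> (src a)" "tgt (push \<theta> a) = \<theta> (tgt a)" "deg (push \<theta> a) = deg a"
  "val (push \<theta> a) = val a" "edge (push \<theta> a) = map_prod \<theta> \<theta> (edge a)"
  "push \<theta> (unit_arr e :: (nat, 'b::field) harr) = unit_arr (map_prod \<theta> \<theta> e)"
  by (auto simp: push_def edge_def unit_arr_def)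

lemma composable_push:
  assumes "\<theta> \<in> delta_maps m n" "composable (ainf_simplex m) as"
  shows "composable (ainf_simplex n) (map (push \<theta>) as)"
  using assms unfolding composable_def delta_maps_def
  by (fastforce simp: is_arr_simplex successively_map mono_on_def elim: successively_mono)

lemma tensor_sum_splits:
  "tensor_sum F g0 g as = (\<Sum>bs\<in>splits as. sgn_pow (eps (map length bs) + koszul bs)
     (F (map (arr_of g0 1 g) bs)))"
  unfolding tensor_sum_def sum_splits
  by (rule sum.cong) (auto simp: map_length_blocks compositions_def)

lemma singleton_blocks: "(\<And>b. b \<in> set bs \<Longrightarrow> length b = 1) \<Longrightarrow> bs = map (\<lambda>a. [a]) (concat bs)"
proof (induction bs)
  case (Cons b bs)
  then have "length b = 1" by simp
  then obtain a where "b = [a]" by (auto simp: length_Suc_conv)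
  with Cons show ?case by simp
qed simp

text \<open>The functor induced by a monotone map is linear: in the formula for the composite only the cut into
blocks of length one contributes, and it carries no sign.\<close>

lemma nerve_act_on_arr:
  fixes A :: "('k::field, 'o, 'v::ab_group_add) ainf"
  assumes A: "ainf_category A" and f: "ainf_functor (ainf_simplex n) A f"
    and \<theta>: "\<theta> \<in> delta_maps m n"
  shows "on_arr (act (ainf_nerve A) m n \<theta> f) as =
    (if composable (ainf_simplex m) as then on_arr f (map (push \<theta>) as) else 0)"
proof (cases "composable (ainf_simplex m) as")
  case as: True
  interpret ainf_category A by fact
  interpret f: ainf_functor "ainf_simplex n" A f by fact
  let ?g = "ainf_simplex_map m \<theta> :: (nat, 'k, nat, 'k) ainf_fun"
  let ?a = "arr_of (on_ob ?g) 1 (on_arr ?g)"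
  let ?bs = "map (\<lambda>a. [a]) as"
  have zero: "on_arr f (map ?a bs) = 0" if bs: "bs \<in> splits as - {?bs}" for bs
  proof -
    from bs have c: "concat bs = as" "[] \<notin> set bs" "bs \<noteq> ?bs" by (auto simp: splits_def)
    then obtain b where b: "b \<in> set bs" "length b \<noteq> 1" using singleton_blocks by blast
    then have "val (?a b) = 0" by (simp add: arr_of_def ainf_simplex_map_def)
    then show ?thesis
      using multilinear_zero[OF simplex.graded_space_axioms f.on_arr_multilinear vector_space_scl,
          of "map ?a bs" "?a b"] b f.on_arr_extensional by auto
  qed
  have "?a [a] = push \<theta> a" if "a \<in> set as" for a
    using as that
    by (auto simp: arr_of_def ainf_simplex_map_def push_def degsum_def composable_def is_arr_simplex)
  then have one: "map ?a ?bs = map (push \<theta>) as" by simp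
  have e: "eps (map length ?bs) = 0" "koszul ?bs = 0"
    by (simp_all add: eps_def koszul_def)
  have "on_arr (act (ainf_nerve A) m n \<theta> f) as = tensor_sum (on_arr f) (on_ob ?g) (on_arr ?g) as"
    using as by (simp add: ainf_nerve_def ainf_fun_comp_def)
  also have "\<dots> = (\<Sum>bs\<in>{?bs}. sgn_pow (eps (map length bs) + koszul bs) (on_arr f (map ?a bs)))"
    unfolding tensor_sum_splits
    by (rule sum.mono_neutral_right[OF finite_splits]) (use zero in \<open>auto simp: splits_def\<close>)
  also have "\<dots> = on_arr f (map (push \<theta>) as)"
    using e one by (simp add: sgn_pow_def del: map_map)
  finally show ?thesis using as by simp
qed (simp add: ainf_nerve_def ainf_fun_comp_def)

lemma nerve_act_on_ob:
  "on_ob (act (ainf_nerve A) m n \<theta> f) = (\<lambda>j\<in>{..m}. on_ob f (\<theta> j))"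
  by (auto simp: ainf_nerve_def ainf_fun_comp_def ainf_simplex_map_def compose_def ainf_simplex_def)

lemma delta_maps_le: "\<theta> \<in> delta_maps m n \<Longrightarrow> j \<le> m \<Longrightarrow> \<theta> j \<le> n"
  by (auto simp: delta_maps_def)

lemma delta_maps_compose:
  assumes "\<eta> \<in> delta_maps l m" "\<theta> \<in> delta_maps m n"
  shows "compose {..l} \<theta> \<eta> \<in> delta_maps l n"
proof -
  have "mono_on {..l} (compose {..l} \<theta> \<eta>)"
  proof (rule mono_onI)
    fix i j assume ij: "i \<in> {..l}" "j \<in> {..l}" "i \<le> j"
    then have "\<eta> i \<le> \<eta> j" using assms(1) by (auto simp: delta_maps_def mono_on_def)
    then have "\<theta> (\<eta> i) \<le> \<theta> (\<eta> j)"
      using assms(2) ij delta_maps_le[OF assms(1)] by (auto simp: delta_maps_def mono_on_def)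
    then show "compose {..l} \<theta> \<eta> i \<le> compose {..l} \<theta> \<eta> j" using ij by (simp add: compose_def)
  qed
  then show ?thesis
    using delta_maps_le[OF assms(2)] delta_maps_le[OF assms(1)]
    by (auto simp: delta_maps_def compose_def)
qed

text \<open>The values of the composite on chains are those of \<open>f\<close> on the image chains, so its functor equation is
inherited through \<open>defect_map\<close>.\<close>

lemma nerve_act_functor:
  fixes A :: "('k::field, 'o, 'v::ab_group_add) ainf"
  assumes A: "ainf_category A" and f: "ainf_functor (ainf_simplex n) A f"
    and \<theta>: "\<theta> \<in> delta_maps m n"
  shows "ainf_functor (ainf_simplex m) A (act (ainf_nerve A) m n \<theta> f)"
proof -
  interpret ainf_category A by fact
  interpret f: simplex_map_data A n "on_ob f" "chain_val f" "on_arr f"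
    by (rule functor_map_data) fact+
  let ?f = "act (ainf_nerve A) m n \<theta> f"
  let ?g = "\<lambda>w. chain_val f (map (map_prod \<theta> \<theta>) w)"
  have end_maps: "fst (last (map (map_prod \<theta> \<theta>) w)) = \<theta> (fst (last w))"
      "snd (hd (map (map_prod \<theta> \<theta>) w)) = \<theta> (snd (hd w))" if "chain m w" for w
    using that by (auto simp: chain_def last_map hd_map)
  interpret act: simplex_map_data A m "on_ob ?f" ?g "on_arr ?f"
  proof
    show "on_ob ?f j \<in> ob A" if "j \<le> m" for j
      using f.x_ob delta_maps_le[OF \<theta>] that by (simp add: nerve_act_on_ob)
    show "?g w \<in> hom A (on_ob ?f (fst (last w))) (on_ob ?f (snd (hd w))) (1 - int (length w))"
      if w: "chain m w" for w
      using f.g_hom[OF chain_map[OF \<theta> w]] chain_ends[OF w] by (simp add: end_maps w nerve_act_on_ob)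
    show "on_arr ?f as = sgn_pow (int (length as choose 2))
        (scl A (prod_list (map val as)) (?g (map edge as)))"
      if as: "composable (ainf_simplex m) as" for as
      using f.F_eq[OF composable_push[OF \<theta> as]] as nerve_act_on_arr[OF A f \<theta>, of as]
      by (simp add: comp_def)
  qed
  have "ainf_functor (ainf_simplex m) A \<lparr>on_ob = on_ob ?f, on_arr = on_arr ?f\<rparr>"
  proof (rule act.ainf_functorI)
    show "defect A (on_ob ?f) ?g w = 0" if w: "chain m w" for w
    proof -
      have "defect A (on_ob ?f) ?g w = defect A (on_ob f \<circ> \<theta>) ?g w"
        by (rule defect_cong[OF w]) (auto simp: nerve_act_on_ob)
      also have "\<dots> = 0"
        using functor_defect[OF A f chain_map[OF \<theta> w]] by (simp add: defect_map)
      finally show ?thesis .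
    qed
    show "?g [(j, j)] = idt A (on_ob ?f j)" if "j \<le> m" for j
      using chain_val_identity[OF f delta_maps_le[OF \<theta> that]] that by (simp add: nerve_act_on_ob)
    show "?g w = 0" if "chain m w" "1 < length w" "(j, j) \<in> set w" for w j
      by (rule chain_val_degenerate[OF f chain_map[OF \<theta>], of _ "\<theta> j"]) (use that in force)+
  qed (auto simp: nerve_act_on_ob nerve_act_on_arr[OF A f \<theta>])
  also have "\<lparr>on_ob = on_ob ?f, on_arr = on_arr ?f\<rparr> = ?f"
    by (rule ainf_fun.equality) simp_all
  finally show ?thesis .
qed

lemma simplicial_set_nerve:
  fixes A :: "('k::field, 'o, 'v::ab_group_add) ainf"
  assumes A: "ainf_category A"
  shows "simplicial_set (ainf_nerve A)"
proof -
  have simp: "f \<in> simp (ainf_nerve A) n \<longleftrightarrow> ainf_functor (ainf_simplex n) A f" for f n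
    by (simp add: ainf_nerve_def)
  have "act (ainf_nerve A) n n (\<lambda>i\<in>{..n}. i) f = f" if f: "ainf_functor (ainf_simplex n) A f" for n f
  proof -
    interpret f: ainf_functor "ainf_simplex n" A f by fact
    have id: "(\<lambda>i\<in>{..n}. i) \<in> delta_maps n n"
      by (auto simp: delta_maps_def mono_on_def)
    show ?thesis
    proof (rule ainf_fun.equality)
      show "on_ob (act (ainf_nerve A) n n (\<lambda>i\<in>{..n}. i) f) = on_ob f"
        using f.on_ob_funcset
        by (auto simp: nerve_act_on_ob ainf_simplex_def PiE_def extensional_def)
      show "on_arr (act (ainf_nerve A) n n (\<lambda>i\<in>{..n}. i) f) = on_arr f"
      proof
        fix as :: "(nat, 'k) harr list"
        have "map (push (\<lambda>i\<in>{..n}. i)) as = map (\<lambda>a. a) as" if "composable (ainf_simplex n) as"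
          using that by (intro map_cong)
            (auto simp: composable_def is_arr_simplex push_def intro: harr.expand)
        then show "on_arr (act (ainf_nerve A) n n (\<lambda>i\<in>{..n}. i) f) as = on_arr f as"
          using nerve_act_on_arr[OF A f id, of as] f.on_arr_extensional by simp
      qed
    qed simp
  qed
  moreover have "act (ainf_nerve A) l n (compose {..l} \<theta> \<eta>) f =
      act (ainf_nerve A) l m \<eta> (act (ainf_nerve A) m n \<theta> f)"
    if \<eta>: "\<eta> \<in> delta_maps l m" and \<theta>: "\<theta> \<in> delta_maps m n" and f: "ainf_functor (ainf_simplex n) A f"
    for l m n \<eta> \<theta> f
  proof (rule ainf_fun.equality)
    have c: "compose {..l} \<theta> \<eta> \<in> delta_maps l n" using \<eta> \<theta> by (rule delta_maps_compose)
    show "on_ob (act (ainf_nerve A) l n (compose {..l} \<theta> \<eta>) f) =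
        on_ob (act (ainf_nerve A) l m \<eta> (act (ainf_nerve A) m n \<theta> f))"
      using delta_maps_le[OF \<eta>] by (auto simp: nerve_act_on_ob compose_def)
    show "on_arr (act (ainf_nerve A) l n (compose {..l} \<theta> \<eta>) f) =
        on_arr (act (ainf_nerve A) l m \<eta> (act (ainf_nerve A) m n \<theta> f))"
    proof
      fix as :: "(nat, 'k) harr list"
      have "map (push (compose {..l} \<theta> \<eta>)) as = map (push \<theta>) (map (push \<eta>) as)"
        if "composable (ainf_simplex l) as"
        using that unfolding map_map
        by (intro map_cong) (auto simp: composable_def is_arr_simplex push_def compose_def)
      then show "on_arr (act (ainf_nerve A) l n (compose {..l} \<theta> \<eta>) f) as =
          on_arr (act (ainf_nerve A) l m \<eta> (act (ainf_nerve A) m n \<theta> f)) as"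
        using nerve_act_on_arr[OF A f c, of as]
          nerve_act_on_arr[OF A nerve_act_functor[OF A f \<theta>] \<eta>, of as]
          nerve_act_on_arr[OF A f \<theta>, of "map (push \<eta>) as"] composable_push[OF \<eta>, of as]
        by (simp del: map_map map_eq_conv)
    qed
  qed simp
  ultimately show ?thesis
    using nerve_act_functor[OF A] by (auto simp: simplicial_set_def simp)
qed

section \<open>The chains of a simplex\<close>

definition vertices :: "(nat \<times> nat) list \<Rightarrow> nat set" where
  "vertices w = fst ` set w \<union> snd ` set w"

lemma vertices_append [simp]: "vertices (u @ v) = vertices u \<union> vertices v"
  by (auto simp: vertices_def)

lemma vertices_Cons: "vertices (e # v) = {fst e, snd e} \<union> vertices v"
  by (auto simp: vertices_def)

lemma vertices_inner_face: "vertices (inner_face r w) \<subseteq> vertices w"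
  by (induction r w rule: inner_face.induct) (auto simp: vertices_Cons)

lemma vertices_chain: "chain n w \<Longrightarrow> vertices w \<subseteq> {..n}"
  by (fastforce simp: vertices_def chain_def)

definition top_chain :: "nat \<Rightarrow> (nat \<times> nat) list" where
  "top_chain k = map (\<lambda>j. (j, Suc j)) (rev [0..<k])"

lemma length_top_chain [simp]: "length (top_chain k) = k"
  by (simp add: top_chain_def)

lemma rev_top_chain: "rev (top_chain k) = map (\<lambda>j. (j, Suc j)) [0..<k]"
  by (simp add: top_chain_def rev_map)

lemma set_top_chain: "set (top_chain k) = (\<lambda>j. (j, Suc j)) ` {..<k}"
  by (auto simp: top_chain_def)

lemma chain_top_chain: "0 < k \<Longrightarrow> chain k (top_chain k)"
  by (auto simp: chain_def top_chain_def successively_conv_nth rev_nth)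

lemma vertices_upt:
  "vertices (map (\<lambda>k. (k, Suc k)) (rev [a..<b])) = {a..<b} \<union> {Suc a..<Suc b}"
  by (auto simp: vertices_def image_image simp flip: image_Suc_atLeastLessThan)

lemma vertices_top_chain: "0 < n \<Longrightarrow> vertices (top_chain n) = {..n}"
  by (auto simp: top_chain_def vertices_upt)

text \<open>A chain with \<open>k\<close> edges is a monotone map \<open>[k] \<rightarrow> [n]\<close>, and it is the image under this map of the full
chain of \<open>[k]\<close>.\<close>

definition vertex_map :: "(nat \<times> nat) list \<Rightarrow> nat \<Rightarrow> nat" where
  "vertex_map w = (\<lambda>j\<in>{..length w}. if j = length w then snd (hd w) else fst (rev w ! j))"

lemma vertex_map_edge:
  assumes "chain n w" "j < length w"
  shows "(vertex_map w j, vertex_map w (Suc j)) = rev w ! j"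
proof -
  have "vertex_map w (Suc j) = snd (rev w ! j)"
  proof (cases "Suc j = length w")
    case True
    then show ?thesis using assms(1)
      by (simp add: vertex_map_def rev_nth hd_conv_nth chain_def)
  next
    case False
    with assms(2) have "Suc (length w - Suc (Suc j)) < length w" by simp
    then have "fst (w ! (length w - Suc (Suc j))) = snd (w ! Suc (length w - Suc (Suc j)))"
      using assms(1) by (simp add: chain_def successively_conv_nth)
    moreover have "Suc (length w - Suc (Suc j)) = length w - Suc j" using False assms(2) by simp
    ultimately show ?thesis using False assms(2) by (simp add: vertex_map_def rev_nth)
  qed
  then show ?thesis using assms(2) by (simp add: vertex_map_def)
qed

lemma map_vertex_map_top_chain:
  assumes "chain n w"
  shows "map (map_prod (vertex_map w) (vertex_map w)) (top_chain (length w)) = w"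
proof -
  have "rev (map (map_prod (vertex_map w) (vertex_map w)) (top_chain (length w))) =
      map (\<lambda>j. (vertex_map w j, vertex_map w (Suc j))) [0..<length w]"
    by (simp add: rev_map rev_top_chain comp_def)
  also have "\<dots> = map ((!) (rev w)) [0..<length (rev w)]"
    using vertex_map_edge[OF assms] by (intro map_cong) auto
  also have "\<dots> = rev w" by (rule map_nth)
  finally show ?thesis by simp
qed

lemma vertex_map_image:
  assumes "chain n w"
  shows "vertex_map w ` {..length w} = vertices w"
proof -
  have "vertices w = vertex_map w ` (vertices (top_chain (length w)))"
    by (subst (1) map_vertex_map_top_chain[OF assms, symmetric]) (auto simp: vertices_def image_image)
  also have "vertices (top_chain (length w)) = {..length w}"
    using assms by (intro vertices_top_chain) (simp add: chain_def)
  finally show ?thesis by simp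
qed

lemma vertex_map_step: "chain n w \<Longrightarrow> j < length w \<Longrightarrow> vertex_map w j \<le> vertex_map w (Suc j)"
  using vertex_map_edge[of n w j] chain_edge[of n w "rev w ! j"] nth_mem[of j "rev w"]
  by (metis fst_conv length_rev set_rev snd_conv)

lemma vertex_map_mono:
  assumes "chain n w" "j \<le> k" "k \<le> length w"
  shows "vertex_map w j \<le> vertex_map w k"
  using assms(2,3)
proof (induction k rule: dec_induct)
  case (step k)
  then show ?case using vertex_map_step[OF assms(1), of k] by simp
qed simp

lemma vertex_map_delta:
  assumes "chain n w"
  shows "vertex_map w \<in> delta_maps (length w) n"
proof -
  have "vertex_map w ` {..length w} \<subseteq> {..n}"
    using vertex_map_image[OF assms] vertices_chain[OF assms] by simp
  moreover have "vertex_map w \<in> extensional {..length w}" by (simp add: vertex_map_def)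
  ultimately show ?thesis
    using vertex_map_mono[OF assms] by (auto simp: delta_maps_def PiE_def intro!: mono_onI)
qed

lemma vertex_map_map:
  "w \<noteq> [] \<Longrightarrow>
   vertex_map (map (map_prod \<theta> \<theta>) w) = compose {..length w} \<theta> (vertex_map w)"
  by (rule ext) (auto simp: vertex_map_def compose_def hd_map rev_map nth_map)

text \<open>The vertices of a strict chain, listed in increasing order, determine it.\<close>

lemma strict_chain_unique:
  assumes w: "chain n w" "\<And>e. e \<in> set w \<Longrightarrow> fst e < snd e"
    and w': "chain n w'" "\<And>e. e \<in> set w' \<Longrightarrow> fst e < snd e"
    and "vertices w = vertices w'"
  shows "w = w'"
proof -
  have sorted: "map (vertex_map w) [0..<Suc (length w)] = sorted_list_of_set (vertices w)"
    if w: "chain n w" "\<And>e. e \<in> set w \<Longrightarrow> fst e < snd e" for w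
  proof -
    have "vertex_map w j < vertex_map w (Suc j)" if "j < length w" for j
      using vertex_map_edge[OF w(1) that] w(2)[of "rev w ! j"] nth_mem[of j "rev w"] that
      by (metis fst_conv length_rev set_rev snd_conv)
    then have "sorted_wrt (<) (map (vertex_map w) [0..<Suc (length w)])"
      by (subst sorted_wrt_iff_nth_Suc_transp) (auto simp del: upt_Suc)
    moreover have "set (map (vertex_map w) [0..<Suc (length w)]) = vertices w"
      using vertex_map_image[OF w(1)] by (simp only: set_map set_upt atLeast0LessThan lessThan_Suc_atMost)
    ultimately show ?thesis
      by (metis strict_sorted_equal sorted_list_of_set.finite_set_strict_sorted strict_sorted_iff
          sorted_list_of_set.idem_if_sorted_distinct)
  qed
  have eq: "map (vertex_map w) [0..<Suc (length w)] = map (vertex_map w') [0..<Suc (length w')]"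
    using sorted[OF w] sorted[OF w'] assms(5) by simp
  from arg_cong[OF this, of length] have len: "length w = length w'" by simp
  have "vertex_map w j = vertex_map w' j" if "j \<le> length w" for j
    using arg_cong[OF eq, of "\<lambda>l. l ! j"] that len by (simp del: upt_Suc)
  then have "map (map_prod (vertex_map w) (vertex_map w)) (top_chain (length w)) =
      map (map_prod (vertex_map w') (vertex_map w')) (top_chain (length w'))"
    by (auto simp: len set_top_chain)
  then show ?thesis
    by (simp only: map_vertex_map_top_chain[OF w(1)] map_vertex_map_top_chain[OF w'(1)])
qed

text \<open>Lists start with the last edge, so removing the vertex \<open>j\<close> means composing at position
\<open>n - 1 - j\<close>.\<close>

lemma inner_face_top_chain:
  assumes "0 < j" "j < n"
  shows "inner_face (n - 1 - j) (top_chain n) =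
    map (\<lambda>k. (k, Suc k)) (rev [Suc j..<n]) @ (j - 1, Suc j) # map (\<lambda>k. (k, Suc k)) (rev [0..<j - 1])"
proof -
  have "[0..<n] = [0..<j - 1] @ [j - 1, j] @ [Suc j..<n]"
    using assms upt_add_eq_append[of 0 "j - 1" "n - (j - 1)"]
    by (simp add: upt_conv_Cons)
  then have "top_chain n = map (\<lambda>k. (k, Suc k)) (rev [Suc j..<n]) @ [(j, Suc j), (j - 1, j)] @
      map (\<lambda>k. (k, Suc k)) (rev [0..<j - 1])"
    using assms by (simp add: top_chain_def)
  moreover have "length (map (\<lambda>k. (k, Suc k)) (rev [Suc j..<n])) + 0 = n - 1 - j" by simp
  ultimately show ?thesis
    using inner_face_append[of 0 "[(j, Suc j), (j - 1, j)]"
        "map (\<lambda>k. (k, Suc k)) (rev [Suc j..<n])" "map (\<lambda>k. (k, Suc k)) (rev [0..<j - 1])"]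
    by simp
qed

lemma vertices_inner_face_top_chain:
  assumes "0 < j" "j < n"
  shows "vertices (inner_face (n - 1 - j) (top_chain n)) = {..n} - {j}"
proof -
  show ?thesis unfolding inner_face_top_chain[OF assms]
    using assms by (auto simp: vertices_Cons vertices_upt)
qed

lemma strict_inner_face_top_chain:
  assumes "0 < j" "j < n" "e \<in> set (inner_face (n - 1 - j) (top_chain n))"
  shows "fst e < snd e"
  using assms(3) unfolding inner_face_top_chain[OF assms(1,2)] by auto

lemma vertices_proper_infix:
  assumes "top_chain n = a @ v @ c" "a \<noteq> [] \<or> c \<noteq> []"
  shows "0 \<notin> vertices v \<or> n \<notin> vertices v"
proof (cases "a = []")
  case False
  have d: "distinct (top_chain n)" by (simp add: top_chain_def distinct_map inj_on_def)
  have "n \<noteq> 0" using assms(1) False by (cases "n = 0") (auto simp: top_chain_def)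
  then have "hd (top_chain n) = (n - 1, n)" by (cases n) (auto simp: top_chain_def)
  then have "(n - 1, n) \<in> set a" using assms(1) False by (cases a) auto
  then have "(n - 1, n) \<notin> set v" using d assms(1) by auto
  moreover have "set v \<subseteq> (\<lambda>j. (j, Suc j)) ` {..<n}"
    unfolding set_top_chain[symmetric] by (auto simp: assms(1))
  ultimately have "n \<notin> vertices v" by (auto simp: vertices_def)
  then show ?thesis ..
next
  case True
  with assms(2) have c: "c \<noteq> []" by simp
  have d: "distinct (top_chain n)" by (simp add: top_chain_def distinct_map inj_on_def)
  have "n \<noteq> 0" using assms(1) c by (cases "n = 0") (auto simp: top_chain_def)
  then have "last (top_chain n) = (0, 1)"
    by (simp add: top_chain_def last_map last_rev hd_upt)
  then have "last c = (0, 1)" using c by (simp add: assms(1))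
  then have "(0, 1) \<in> set c" using c last_in_set[of c] by simp
  then have "(0, 1) \<notin> set v" using d assms(1) by auto
  moreover have "set v \<subseteq> (\<lambda>j. (j, Suc j)) ` {..<n}"
    unfolding set_top_chain[symmetric] by (auto simp: assms(1))
  ultimately have "0 \<notin> vertices v" by (auto simp: vertices_def)
  then show ?thesis ..
qed

section \<open>Filling an inner horn\<close>

locale horn_in_nerve = ainf_category A
  for A :: "('k::field, 'o, 'v::ab_group_add) ainf" +
  fixes n i :: nat and \<gamma> :: "nat \<Rightarrow> (nat \<Rightarrow> nat) \<Rightarrow> (nat, 'k, 'o, 'v) ainf_fun"
  assumes i_pos: "0 < i" and i_less: "i < n"
    and \<gamma>_map: "simplicial_map (horn n i) (ainf_nerve A) \<gamma>"
begin

abbreviation in_horn :: "nat \<Rightarrow> (nat \<Rightarrow> nat) \<Rightarrow> bool" where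
  "in_horn k \<sigma> \<equiv> \<sigma> \<in> simp (horn n i) k"

lemma in_horn_iff: "in_horn k \<sigma> \<longleftrightarrow> \<sigma> \<in> delta_maps k n \<and> \<not> {..n} - {i} \<subseteq> \<sigma> ` {..k}"
  by (auto simp: horn_def)

lemma horn_functor: "in_horn k \<sigma> \<Longrightarrow> ainf_functor (ainf_simplex k) A (\<gamma> k \<sigma>)"
  using \<gamma>_map by (auto simp: simplicial_map_def ainf_nerve_def)

lemma horn_natural:
  "in_horn k \<sigma> \<Longrightarrow> \<theta> \<in> delta_maps m k \<Longrightarrow>
   \<gamma> m (compose {..m} \<sigma> \<theta>) = act (ainf_nerve A) m k \<theta> (\<gamma> k \<sigma>)"
  using \<gamma>_map by (auto simp: simplicial_map_def horn_def)

definition point :: "nat \<Rightarrow> nat \<Rightarrow> nat" where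
  "point j = (\<lambda>_\<in>{..0}. j)"

lemma point_delta: "j \<le> m \<Longrightarrow> point j \<in> delta_maps 0 m"
  by (auto simp: point_def delta_maps_def mono_on_def)

lemma not_spanning_singleton: "\<not> {..n} - {i} \<subseteq> {j}"
proof
  assume a: "{..n} - {i} \<subseteq> {j}"
  have "0 \<in> {..n} - {i}" "n \<in> {..n} - {i}" using i_pos i_less by auto
  with a have "0 = n" by blast
  then show False using i_less by simp
qed

lemma point_in_horn: "j \<le> n \<Longrightarrow> in_horn 0 (point j)"
  using not_spanning_singleton[of j] by (simp add: in_horn_iff point_delta) (simp add: point_def)

definition vertex :: "nat \<Rightarrow> 'o" where
  "vertex = (\<lambda>j\<in>{..n}. on_ob (\<gamma> 0 (point j)) 0)"

lemma on_ob_horn: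
  assumes "in_horn k \<sigma>" "j \<le> k"
  shows "on_ob (\<gamma> k \<sigma>) j = vertex (\<sigma> j)"
proof -
  have "compose {..0} \<sigma> (point j) = point (\<sigma> j)" by (auto simp: point_def compose_def)
  then have "\<gamma> 0 (point (\<sigma> j)) = act (ainf_nerve A) 0 k (point j) (\<gamma> k \<sigma>)"
    using horn_natural[OF assms(1) point_delta[OF assms(2)]] by simp
  moreover have "\<sigma> j \<le> n" using assms delta_maps_le[of \<sigma> k n j] by (simp add: in_horn_iff)
  ultimately show ?thesis by (simp add: vertex_def nerve_act_on_ob) (simp add: point_def)
qed

lemma vertex_ob: "j \<le> n \<Longrightarrow> vertex j \<in> ob A"
  using ainf_functor.on_ob_funcset[OF horn_functor[OF point_in_horn]]
  by (auto simp: vertex_def)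

text \<open>A chain is not spanning iff it lies in the horn, that is, misses a vertex other than \<open>i\<close>.\<close>

definition spanning :: "(nat \<times> nat) list \<Rightarrow> bool" where
  "spanning w \<longleftrightarrow> {..n} - {i} \<subseteq> vertices w"

text \<open>The value that the horn prescribes for a chain \<open>w\<close>: the simplex \<open>vertex_map w\<close> of the horn is sent to a
functor, which is evaluated on the full chain of its source.  On spanning chains the value
\<open>0\<close> is provisional; the filler changes it on a single chain.\<close>

definition horn_val :: "(nat \<times> nat) list \<Rightarrow> 'v" where
  "horn_val w = (if chain n w \<and> \<not> spanning w
     then chain_val (\<gamma> (length w) (vertex_map w)) (top_chain (length w)) else 0)"

lemma chain_val_act:
  assumes "ainf_functor (ainf_simplex k) A f" "\<theta> \<in> delta_maps m k" "chain m w"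
  shows "chain_val (act (ainf_nerve A) m k \<theta> f) w = chain_val f (map (map_prod \<theta> \<theta>) w)"
  using nerve_act_on_arr[OF ainf_category_axioms assms(1,2), of "map unit_arr w"] assms(3)
  by (simp add: chain_val_def composable_units comp_def)

lemma vertices_map: "vertices (map (map_prod \<sigma> \<sigma>) w) = \<sigma> ` vertices w"
  by (auto simp: vertices_def image_image image_Un)

text \<open>By naturality any simplex of the horn through which a chain factors may be used to compute its value.\<close>

lemma horn_val_map:
  assumes "in_horn k \<sigma>" "chain k w"
  shows "horn_val (map (map_prod \<sigma> \<sigma>) w) = chain_val (\<gamma> k \<sigma>) w"
proof -
  have \<sigma>: "\<sigma> \<in> delta_maps k n" "\<not> {..n} - {i} \<subseteq> \<sigma> ` {..k}" using assms(1) by (auto simp: in_horn_iff)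
  have "vertices (map (map_prod \<sigma> \<sigma>) w) \<subseteq> \<sigma> ` {..k}"
    using vertices_chain[OF assms(2)] by (auto simp: vertices_map)
  with \<sigma> have "\<not> spanning (map (map_prod \<sigma> \<sigma>) w)" by (auto simp: spanning_def)
  moreover have "w \<noteq> []" using assms(2) by (simp add: chain_def)
  ultimately have "horn_val (map (map_prod \<sigma> \<sigma>) w) =
      chain_val (\<gamma> (length w) (compose {..length w} \<sigma> (vertex_map w))) (top_chain (length w))"
    using chain_map[OF \<sigma>(1) assms(2)] by (simp add: horn_val_def vertex_map_map)
  also have "\<dots> = chain_val (act (ainf_nerve A) (length w) k (vertex_map w) (\<gamma> k \<sigma>)) (top_chain (length w))"
    by (simp add: horn_natural[OF assms(1) vertex_map_delta[OF assms(2)]])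
  also have "\<dots> = chain_val (\<gamma> k \<sigma>) w"
    using chain_val_act[OF horn_functor[OF assms(1)] vertex_map_delta[OF assms(2)]]
      chain_top_chain[of "length w"] \<open>w \<noteq> []\<close> map_vertex_map_top_chain[OF assms(2)] by simp
  finally show ?thesis .
qed

text \<open>A chain in the horn lies in the face opposite to some vertex \<open>m \<noteq> i\<close>; the coface map that misses \<open>m\<close> is
injective, so the lift keeps the identity edges of the chain.\<close>

lemma nonspanning_lift:
  assumes w: "chain n w" "\<not> spanning w"
  obtains \<sigma> w' where "in_horn (n - 1) \<sigma>" "chain (n - 1) w'" "w = map (map_prod \<sigma> \<sigma>) w'"
    "\<And>j. (j, j) \<in> set w \<Longrightarrow> \<exists>j'. (j', j') \<in> set w'"
proof -
  obtain m where m: "m \<le> n" "m \<noteq> i" "m \<notin> vertices w"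
    using w(2) by (auto simp: spanning_def)
  define \<sigma> where "\<sigma> = (\<lambda>j\<in>{..n - 1}. if j < m then j else Suc j)"
  \<comment> \<open>A monotone left inverse of \<open>\<sigma>\<close> that is injective away from \<open>m\<close>.\<close>
  define \<rho> where "\<rho> j = (if j < m then j else j - 1)" for j :: nat
  have n: "0 < n" using i_less by simp
  have \<sigma>: "\<sigma> \<in> delta_maps (n - 1) n"
    using m n by (auto simp: \<sigma>_def delta_maps_def mono_on_def)
  have "m \<notin> \<sigma> ` {..n - 1}" by (auto simp: \<sigma>_def)
  with \<sigma> m have h: "in_horn (n - 1) \<sigma>" by (auto simp: in_horn_iff)
  have v: "fst e \<noteq> m \<and> snd e \<noteq> m \<and> fst e \<le> snd e \<and> snd e \<le> n" if "e \<in> set w" for e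
    using that m w chain_edge[of n w e] by (auto simp: vertices_def)
  have c: "chain (n - 1) (map (map_prod \<rho> \<rho>) w)"
    using w(1) unfolding chain_def
  proof (elim conjE, intro conjI)
    show "\<forall>(a, b)\<in>set (map (map_prod \<rho> \<rho>) w). a \<le> b \<and> b \<le> n - 1"
    proof clarify
      fix a b assume "(a, b) \<in> set (map (map_prod \<rho> \<rho>) w)"
      then obtain e where e: "e \<in> set w" "a = \<rho> (fst e)" "b = \<rho> (snd e)" by auto
      have "\<rho> (fst e) \<le> \<rho> (snd e)" using v[OF e(1)] by (auto simp: \<rho>_def)
      moreover have "\<rho> (snd e) \<le> n - 1" using v[OF e(1)] m by (auto simp: \<rho>_def)
      ultimately show "a \<le> b \<and> b \<le> n - 1" by (simp add: e)
    qed
    assume "successively (\<lambda>p q. fst p = snd q) w"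
    then show "successively (\<lambda>p q. fst p = snd q) (map (map_prod \<rho> \<rho>) w)"
      unfolding successively_map by (rule successively_mono) auto
  qed auto
  have inv: "\<sigma> (\<rho> j) = j" if "j \<noteq> m" "j \<le> n" for j
    using that m n by (auto simp: \<sigma>_def \<rho>_def)
  have "map (map_prod \<sigma> \<sigma>) (map (map_prod \<rho> \<rho>) w) = map (\<lambda>e. e) w"
    unfolding map_map
    using v inv by (intro map_cong refl) (auto simp: map_prod_def split_beta, metis order_trans prod.collapse)
  then show ?thesis using that[OF h c] by (force simp del: map_map)
qed

lemma horn_val_hom:
  assumes "chain n w"
  shows "horn_val w \<in> hom A (vertex (fst (last w))) (vertex (snd (hd w))) (1 - int (length w))"
proof (cases "spanning w")
  case True
  then show ?thesis using chain_ends[OF assms] by (simp add: horn_val_def hom_0 vertex_ob)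
next
  case False
  then obtain \<sigma> w' where w': "in_horn (n - 1) \<sigma>" "chain (n - 1) w'" "w = map (map_prod \<sigma> \<sigma>) w'"
    using nonspanning_lift assms by metis
  interpret f: simplex_map_data A "n - 1" "on_ob (\<gamma> (n - 1) \<sigma>)" "chain_val (\<gamma> (n - 1) \<sigma>)"
      "on_arr (\<gamma> (n - 1) \<sigma>)"
    using ainf_category_axioms horn_functor[OF w'(1)] by (rule functor_map_data)
  have "w' \<noteq> []" using w'(2) by (simp add: chain_def)
  then show ?thesis
    using f.g_hom[OF w'(2)] chain_ends[OF w'(2)] on_ob_horn[OF w'(1)]
    by (simp add: w'(3) horn_val_map[OF w'(1,2)] last_map hd_map)
qed

sublocale horn: simplex_data A n vertex horn_val
  by unfold_locales (auto intro: vertex_ob horn_val_hom)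

lemma defect_horn:
  assumes "chain n w" "\<not> spanning w"
  shows "defect A vertex horn_val w = 0"
proof -
  obtain \<sigma> w' where w': "in_horn (n - 1) \<sigma>" "chain (n - 1) w'" "w = map (map_prod \<sigma> \<sigma>) w'"
    using nonspanning_lift assms by metis
  have "defect A vertex horn_val w =
      defect A (vertex \<circ> \<sigma>) (\<lambda>w. horn_val (map (map_prod \<sigma> \<sigma>) w)) w'"
    by (simp add: w'(3) defect_map)
  also have "\<dots> = defect A (on_ob (\<gamma> (n - 1) \<sigma>)) (chain_val (\<gamma> (n - 1) \<sigma>)) w'"
  proof (rule defect_cong[OF w'(2)])
    show "horn_val (map (map_prod \<sigma> \<sigma>) b) = chain_val (\<gamma> (n - 1) \<sigma>) b"
      if "bs \<in> splits w'" "b \<in> set bs" for bs b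
      using that w'(2) chain_block[of "n - 1" bs b]
      by (intro horn_val_map[OF w'(1)]) (auto simp: splits_def)
    show "horn_val (map (map_prod \<sigma> \<sigma>) (inner_face r w')) =
        chain_val (\<gamma> (n - 1) \<sigma>) (inner_face r w')" if "Suc r < length w'" for r
      by (intro horn_val_map[OF w'(1)] chain_inner_face w'(2) that)
    show "(vertex \<circ> \<sigma>) j = on_ob (\<gamma> (n - 1) \<sigma>) j" if "j \<le> n - 1" for j
      using on_ob_horn[OF w'(1) that] by simp
  qed
  also have "\<dots> = 0"
    by (rule functor_defect[OF ainf_category_axioms horn_functor[OF w'(1)] w'(2)])
  finally show ?thesis .
qed

lemma horn_val_identity: "j \<le> n \<Longrightarrow> horn_val [(j, j)] = idt A (vertex j)"
  using horn_val_map[OF point_in_horn, of j "[(0, 0)]"]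
    chain_val_identity[OF horn_functor[OF point_in_horn], of j 0] on_ob_horn[OF point_in_horn, of j 0]
  by (simp add: chain_def) (simp add: point_def)

lemma horn_val_degenerate:
  assumes "chain n w" "length w > 1" "(j, j) \<in> set w"
  shows "horn_val w = 0"
proof (cases "spanning w")
  case False
  then obtain \<sigma> w' where w': "in_horn (n - 1) \<sigma>" "chain (n - 1) w'" "w = map (map_prod \<sigma> \<sigma>) w'"
    and "\<And>j. (j, j) \<in> set w \<Longrightarrow> \<exists>j'. (j', j') \<in> set w'"
    using nonspanning_lift assms(1) by metis
  with assms(3) obtain j' where "(j', j') \<in> set w'" by blast
  then show ?thesis
    using chain_val_degenerate[OF horn_functor[OF w'(1)] w'(2)] assms(2) w'
    by (simp add: horn_val_map)
qed (simp add: horn_val_def)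

text \<open>The horn lacks exactly two nondegenerate simplices: the full chain and this face of it.\<close>

definition missing_face :: "(nat \<times> nat) list" where
  "missing_face = inner_face (n - 1 - i) (top_chain n)"

text \<open>The defect of the full chain contains \<open>(-1)\<^sup>r g(missing_face)\<close> with \<open>r = n - 1 - i\<close>; the chosen value
makes it cancel the rest.\<close>

definition filler_val :: "(nat \<times> nat) list \<Rightarrow> 'v" where
  "filler_val w = (if w = missing_face
     then - sgn_pow (int (n - 1 - i)) (defect A vertex horn_val (top_chain n)) else horn_val w)"

lemma n_pos: "0 < n" using i_less by simp

lemma chain_top: "chain n (top_chain n)"
  by (rule chain_top_chain[OF n_pos])

lemma chain_missing: "chain n missing_face"
  unfolding missing_face_def
  by (rule chain_inner_face[OF chain_top]) (use i_pos i_less in auto)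

lemma length_missing: "length missing_face = n - 1"
  unfolding missing_face_def using i_pos i_less by (subst length_inner_face) auto

lemma vertices_missing: "vertices missing_face = {..n} - {i}"
  unfolding missing_face_def by (rule vertices_inner_face_top_chain[OF i_pos i_less])

lemma spanning_missing: "spanning missing_face"
  by (simp add: spanning_def vertices_missing)

lemma filler_val_nonspanning: "\<not> spanning w \<Longrightarrow> filler_val w = horn_val w"
  using spanning_missing by (auto simp: filler_val_def)

lemma missing_strict: "e \<in> set missing_face \<Longrightarrow> fst e < snd e"
  unfolding missing_face_def by (rule strict_inner_face_top_chain[OF i_pos i_less])

lemma filler_val_hom:
  assumes "chain n w"
  shows "filler_val w \<in> hom A (vertex (fst (last w))) (vertex (snd (hd w))) (1 - int (length w))"
proof (cases "w = missing_face")
  case True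
  have "Suc (n - 1 - i) < length (top_chain n)" using i_pos i_less by simp
  note ends = inner_face_ends[OF this]
  then have "fst (last w) = fst (last (top_chain n))" "snd (hd w) = snd (hd (top_chain n))"
    by (simp_all only: True missing_face_def)
  moreover have "1 - int (length w) = 2 - int (length (top_chain n))"
    using True n_pos by (simp add: length_missing of_nat_diff)
  moreover have "filler_val w = sgn_pow (1 + int (n - 1 - i)) (defect A vertex horn_val (top_chain n))"
    using True by (simp add: filler_val_def sgn_pow_def)
  ultimately show ?thesis
    using hom_sgn_pow[OF horn.ends_ob[OF chain_top] horn.defect_hom[OF chain_top]] by (simp only:)
qed (simp add: filler_val_def horn_val_hom assms)

sublocale filler: simplex_data A n vertex filler_val
  by unfold_locales (auto intro: vertex_ob filler_val_hom)

lemma inner_face_top_nonspanning: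
  assumes "r < n - 1" "r \<noteq> n - 1 - i"
  shows "\<not> spanning (inner_face r (top_chain n))"
proof -
  define j where "j = n - 1 - r"
  have j: "0 < j" "j < n" "r = n - 1 - j" "j \<noteq> i" using assms i_less by (auto simp: j_def)
  have "vertices (inner_face r (top_chain n)) = {..n} - {j}"
    unfolding j(3) by (rule vertices_inner_face_top_chain[OF j(1,2)])
  moreover have "j \<in> {..n} - {i}" using j(2,4) by simp
  ultimately show ?thesis unfolding spanning_def by blast
qed

text \<open>This is where innerness enters: a proper block of the full chain misses one of the end vertices,
which are both different from \<open>i\<close>.\<close>

lemma infix_top_nonspanning:
  assumes "top_chain n = a @ v @ c" "a \<noteq> [] \<or> c \<noteq> []"
  shows "\<not> spanning v"
  using vertices_proper_infix[OF assms] i_pos i_less by (auto simp: spanning_def)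

lemma defect_filler_top: "defect A vertex filler_val (top_chain n) = 0"
proof -
  let ?r = "n - 1 - i" and ?T = "top_chain n"
  have "filler_val b = horn_val b" if bs: "bs \<in> splits ?T" "b \<in> set bs" for bs b
  proof -
    obtain us ws where "bs = us @ b # ws" using split_list[OF bs(2)] by blast
    then have T: "?T = concat us @ b @ concat ws" using bs by (simp add: splits_def)
    show ?thesis
    proof (cases "concat us = [] \<and> concat ws = []")
      case True
      then have "length b = n" using arg_cong[OF T, of length] by simp
      then have "length b \<noteq> length missing_face" using length_missing n_pos by linarith
      then have "b \<noteq> missing_face" by blast
      then show ?thesis by (simp add: filler_val_def)
    next
      case False
      then show ?thesis using infix_top_nonspanning[OF T] filler_val_nonspanning by blast
    qed
  qed
  then have garr: "map (garr vertex filler_val) bs = map (garr vertex horn_val) bs"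
    if "bs \<in> splits ?T" for bs
    using that by (auto simp: garr_def)
  have "horn_val missing_face = 0" by (simp add: horn_val_def spanning_missing)
  then have at_missing: "horn_val (inner_face ?r ?T) = 0"
      "filler_val (inner_face ?r ?T) = - sgn_pow (int ?r) (defect A vertex horn_val ?T)"
    by (simp_all add: filler_val_def missing_face_def)
  have "(\<Sum>r<n - 1. sgn_pow (int r) (filler_val (inner_face r ?T))) -
      (\<Sum>r<n - 1. sgn_pow (int r) (horn_val (inner_face r ?T))) =
      (\<Sum>r<n - 1. sgn_pow (int r) (filler_val (inner_face r ?T)) - sgn_pow (int r) (horn_val (inner_face r ?T)))"
    by (simp add: sum_subtractf)
  also have "\<dots> = (\<Sum>r\<in>{?r}. sgn_pow (int r) (filler_val (inner_face r ?T)) - sgn_pow (int r) (horn_val (inner_face r ?T)))"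
    by (rule sum.mono_neutral_right)
       (use i_pos i_less inner_face_top_nonspanning filler_val_nonspanning in auto)
  also have "\<dots> = sgn_pow (int ?r) (filler_val (inner_face ?r ?T)) -
      sgn_pow (int ?r) (horn_val (inner_face ?r ?T))"
    by simp
  also have "\<dots> = - defect A vertex horn_val ?T"
    unfolding at_missing by (simp add: sgn_pow_def)
  finally show ?thesis
    by (simp add: defect_def[of A vertex filler_val] garr cong: sum.cong)
       (simp add: defect_def algebra_simps)
qed

lemma defect_filler_nonspanning:
  assumes "chain n w" "\<not> spanning w"
  shows "defect A vertex filler_val w = 0"
proof -
  have "defect A vertex filler_val w = defect A vertex horn_val w"
  proof (rule defect_cong[OF assms(1) refl])
    show "filler_val b = horn_val b" if "bs \<in> splits w" "b \<in> set bs" for bs b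
    proof -
      have "set b \<subseteq> set w" using that by (auto simp: splits_def)
      then have "vertices b \<subseteq> vertices w" by (auto simp: vertices_def)
      then show ?thesis using assms(2) by (intro filler_val_nonspanning) (auto simp: spanning_def)
    qed
    show "filler_val (inner_face r w) = horn_val (inner_face r w)" if "Suc r < length w" for r
      using assms(2) vertices_inner_face[of r w]
      by (intro filler_val_nonspanning) (auto simp: spanning_def)
  qed
  then show ?thesis using defect_horn[OF assms] by simp
qed

text \<open>No equation is left to adjust here; the vanishing is forced by the identity for the defects of the full
chain, its blocks and its inner faces.\<close>

lemma defect_filler_missing: "defect A vertex filler_val missing_face = 0"
  unfolding missing_face_def
proof (rule filler.defect_inner_face_zero[OF chain_top])
  show "n - 1 - i < length (top_chain n) - 1" using i_pos i_less by simp
  show "defect A vertex filler_val v = 0" if "(us, v, ws) \<in> block_cuts (top_chain n)" for us v ws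
  proof -
    have T: "top_chain n = concat us @ v @ concat ws" "v \<noteq> []" using that by (auto simp: block_cuts_def)
    then have v: "chain n v" using chain_top chain_infix[of n "concat us" v "concat ws"] by simp
    show ?thesis
    proof (cases "concat us = [] \<and> concat ws = []")
      case True
      then have "v = top_chain n" using T(1) by (metis append_Nil append_Nil2)
      then show ?thesis using defect_filler_top by simp
    next
      case False
      then show ?thesis using infix_top_nonspanning[OF T(1)] v defect_filler_nonspanning by blast
    qed
  qed
  show "defect A vertex filler_val (inner_face r (top_chain n)) = 0"
    if "r < length (top_chain n) - 1" "r \<noteq> n - 1 - i" for r
    using that by (intro defect_filler_nonspanning chain_inner_face chain_top inner_face_top_nonspanning) auto
qed

lemma filler_val_identity: "j \<le> n \<Longrightarrow> filler_val [(j, j)] = idt A (vertex j)"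
  using horn_val_identity[of j] filler_val_nonspanning[of "[(j, j)]"] not_spanning_singleton[of j]
  by (simp add: spanning_def vertices_def)

lemma filler_val_degenerate:
  "chain n w \<Longrightarrow> length w > 1 \<Longrightarrow> (j, j) \<in> set w \<Longrightarrow> filler_val w = 0"
  using horn_val_degenerate[of w j] missing_strict[of "(j, j)"]
  by (auto simp: filler_val_def)

lemma defect_filler:
  assumes w: "chain n w"
  shows "defect A vertex filler_val w = 0"
proof (cases "\<exists>j. (j, j) \<in> set w")
  case True
  then obtain j u v where uv: "w = u @ (j, j) # v" by (meson split_list)
  show ?thesis unfolding uv
  proof (rule filler.defect_degenerate)
    show "filler_val [(k, k)] = idt A (vertex k)" if "k \<le> n" for k
      by (rule filler_val_identity[OF that])
    show "filler_val w' = 0" if "chain n w'" "length w' > 1" "(k, k) \<in> set w'" for w' k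
      by (rule filler_val_degenerate[OF that])
    show "chain n (u @ (j, j) # v)" using w uv by simp
  qed
next
  case False
  have strict: "fst e < snd e" if "e \<in> set w" for e
    using chain_edge[OF w that] False that by (cases e) (auto simp: le_less)
  have top: "fst e < snd e" if "e \<in> set (top_chain n)" for e
    using that by (auto simp: set_top_chain)
  show ?thesis
  proof (cases "spanning w")
    case True
    then consider "vertices w = {..n}" | "vertices w = {..n} - {i}"
      using vertices_chain[OF w] by (auto simp: spanning_def)
    then show ?thesis
    proof cases
      case 1
      then have "w = top_chain n"
        using strict_chain_unique[OF w strict chain_top top] vertices_top_chain[OF n_pos] by simp
      then show ?thesis using defect_filler_top by simp
    next
      case 2
      then have "w = missing_face"
        using strict_chain_unique[OF w strict chain_missing missing_strict] vertices_missing by simp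
      then show ?thesis using defect_filler_missing by simp
    qed
  qed (rule defect_filler_nonspanning[OF w])
qed

definition filler :: "(nat, 'k, 'o, 'v) ainf_fun" where
  "filler = \<lparr>on_ob = vertex, on_arr = (\<lambda>as.
     if composable (ainf_simplex n :: ('k, nat, 'k) ainf) as
     then sgn_pow (int (length as choose 2)) (scl A (prod_list (map val as)) (filler_val (map edge as)))
     else 0)\<rparr>"

lemma filler_functor: "ainf_functor (ainf_simplex n) A filler"
proof -
  interpret simplex_map_data A n vertex filler_val "on_arr filler"
    by unfold_locales (simp add: filler_def)
  have "vertex \<in> extensional {..n}" by (simp add: vertex_def)
  then have "ainf_functor (ainf_simplex n) A \<lparr>on_ob = vertex, on_arr = on_arr filler\<rparr>"
    by (rule ainf_functorI)
       (auto simp: filler_def defect_filler filler_val_identity filler_val_degenerate)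
  then show ?thesis by (simp add: filler_def)
qed

text \<open>Both sides have the same values on chains, and the chains of a simplex of the horn are sent to nonspanning
ones.\<close>

lemma filler_extends:
  assumes \<sigma>: "in_horn k \<sigma>"
  shows "act (ainf_nerve A) k n \<sigma> filler = \<gamma> k \<sigma>"
proof (rule ainf_fun.equality)
  interpret f: ainf_functor "ainf_simplex k" A "\<gamma> k \<sigma>" by (rule horn_functor[OF \<sigma>])
  interpret data: simplex_map_data A k "on_ob (\<gamma> k \<sigma>)" "chain_val (\<gamma> k \<sigma>)" "on_arr (\<gamma> k \<sigma>)"
    using ainf_category_axioms f.ainf_functor_axioms by (rule functor_map_data)
  have \<sigma>': "\<sigma> \<in> delta_maps k n" "\<not> {..n} - {i} \<subseteq> \<sigma> ` {..k}" using \<sigma> by (auto simp: in_horn_iff)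
  show "on_ob (act (ainf_nerve A) k n \<sigma> filler) = on_ob (\<gamma> k \<sigma>)"
    using f.on_ob_funcset on_ob_horn[OF \<sigma>]
    by (auto simp: nerve_act_on_ob filler_def PiE_def extensional_def)
  show "on_arr (act (ainf_nerve A) k n \<sigma> filler) = on_arr (\<gamma> k \<sigma>)"
  proof
    fix as :: "(nat, 'k) harr list"
    show "on_arr (act (ainf_nerve A) k n \<sigma> filler) as = on_arr (\<gamma> k \<sigma>) as"
    proof (cases "composable (ainf_simplex k) as")
      case as: True
      let ?w = "map edge as"
      have "on_arr (act (ainf_nerve A) k n \<sigma> filler) as = sgn_pow (int (length as choose 2))
          (scl A (prod_list (map val as)) (filler_val (map (map_prod \<sigma> \<sigma>) ?w)))"
        using nerve_act_on_arr[OF ainf_category_axioms filler_functor \<sigma>'(1), of as] as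
          composable_push[OF \<sigma>'(1) as] by (simp add: filler_def comp_def)
      also have "scl A (prod_list (map val as)) (filler_val (map (map_prod \<sigma> \<sigma>) ?w)) =
          scl A (prod_list (map val as)) (chain_val (\<gamma> k \<sigma>) ?w)"
      proof (cases "prod_list (map val as) = 0")
        case False
        then have w: "chain k ?w" using composable_nonzero(1)[OF as] by blast
        have "vertices (map (map_prod \<sigma> \<sigma>) ?w) \<subseteq> \<sigma> ` {..k}"
          using vertices_chain[OF w] unfolding vertices_map by blast
        then have "\<not> spanning (map (map_prod \<sigma> \<sigma>) ?w)" using \<sigma>'(2) by (auto simp: spanning_def)
        then show ?thesis using horn_val_map[OF \<sigma> w] filler_val_nonspanning by simp
      qed simp
      finally show ?thesis using data.F_eq[OF as] by simp
    qed (simp add: nerve_act_on_arr[OF ainf_category_axioms filler_functor \<sigma>'(1)] f.on_arr_extensional)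
  qed
qed simp

end

theorem proposition2p2p12:
  fixes A :: "('k::field, 'o, 'v::ab_group_add) ainf"
  assumes "ainf_category A"
  shows "infinity_category (ainf_nerve A)"
  unfolding infinity_category_def
proof (intro conjI allI impI)
  let ?N = "ainf_nerve A"
  show sset: "simplicial_set ?N" by (rule simplicial_set_nerve[OF assms])
  fix n i \<gamma> assume "0 < i" "i < n" "simplicial_map (horn n i) ?N \<gamma>"
  with assms interpret horn_in_nerve A n i \<gamma>
    by (simp add: horn_in_nerve_def horn_in_nerve_axioms_def)
  have "simplicial_map (std_simplex n) ?N (\<lambda>k \<sigma>. act ?N k n \<sigma> filler)"
    using sset filler_functor nerve_act_functor[OF assms filler_functor]
    by (auto simp: simplicial_map_def simplicial_set_def std_simplex_def ainf_nerve_def)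
  moreover have "\<forall>k. \<forall>\<sigma>\<in>simp (horn n i) k. act ?N k n \<sigma> filler = \<gamma> k \<sigma>"
    using filler_extends by blast
  ultimately show "\<exists>h. simplicial_map (std_simplex n) ?N h \<and>
      (\<forall>k. \<forall>\<sigma>\<in>simp (horn n i) k. h k \<sigma> = \<gamma> k \<sigma>)" by blast
qed

end
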